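(* Let $F(u+\tfrac12,v+\tfrac12)>0$, $A(u,v)$ and $B(u,v)$ be given real functions of the discrete variables $(u,v)\in D\subset\mathbb{Z}^2$ satisfying the compatibility equations $$F(u-\tfrac12,v+\tfrac12)F(u+\tfrac12,v-\tfrac12)-F(u+\tfrac12,v+\tfrac12)F(u-\tfrac12,v-\tfrac12)=A(u,v)B(u,v),$$ $$F(u-\tfrac12,v-\tfrac12)B_1(u+\tfrac12,v)-F(u+\tfrac12,v-\tfrac12)B_1(u-\tfrac12,v)=B(u,v)A_2(u,v-\tfrac12),$$ $$F(u-\tfrac12,v-\tfrac12)A_2(u,v+\tfrac12)-F(u-\tfrac12,v+\tfrac12)A_2(u,v-\tfrac12)=A(u,v)B_1(u-\tfrac12,v).$$ Then there exists a discrete affine minimal surface $q(u,v)$ with quadratic form $F\,du\,dv$ and cubic form $A\,\delta u^3+B\,\delta v^3$. Moreover, two discrete affine minimal surfaces with the same quadratic and cubic forms are affine equivalent, i.e. they differ by an affine transformation of $\mathbb{R}^3$.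
   Context: $\cdot$, $\times$, $[\cdot,\cdot,\cdot]$ are the inner product, cross product and determinant in $\mathbb{R}^3$. For a function $f$ on a subset of $\mathbb{Z}^2$: $f_1(u+\tfrac12,v)=f(u+1,v)-f(u,v)$, $f_2(u,v+\tfrac12)=f(u,v+1)-f(u,v)$, $f_{12}(u+\tfrac12,v+\tfrac12)=f(u+1,v+1)+f(u,v)-f(u+1,v)-f(u,v+1)$. The label $(u+\tfrac12,v+\tfrac12)$ denotes the unit square with lower-left vertex $(u,v)$. A discrete co-normal map is $\nu:D\subset\mathbb{Z}^2\to\mathbb{R}^3$ with $\nu_{12}(u+\tfrac12,v+\tfrac12)=0$ and $F(u+\tfrac12,v+\tfrac12):=\nu(u,v)\cdot(\nu(u,v+1)\times\nu(u+1,v))>0$ for $(u,v)\in D$. A discrete affine minimal surface (map) is a map $q:D\to\mathbb{R}^3$ for which there is a discrete co-normal map $\nu$ with $q_1(u+\tfrac12,v)=\nu(u,v)\times\nu(u+1,v)$ and $q_2(u,v+\tfrac12)=-\nu(u,v)\times\nu(u,v+1)$. Having quadratic form $F\,du\,dv$ means that the function $F$ of $q$ just defined (its discrete affine metric) is the given $F$; it satisfies $F^2(u+\tfrac12,v+\tfrac12)=[q_1(u+\tfrac12,v),q_2(u,v+\tfrac12),q_{12}(u+\tfrac12,v+\tfrac12)]$. The affine normal is $\xi(u+\tfrac12,v+\tfrac12)=q_{12}(u+\tfrac12,v+\tfrac12)/F(u+\tfrac12,v+\tfrac12)$. The discrete cubic form of $q$ is $A(u,v)\,\delta u^3+B(u,v)\,\delta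 v^3$ with coefficients $$A(u,v)=[q_1(u-\tfrac12,v),q_1(u+\tfrac12,v),\xi(u\pm\tfrac12,v\pm\tfrac12)],\qquad B(u,v)=[q_2(u,v+\tfrac12),q_2(u,v-\tfrac12),\xi(u\pm\tfrac12,v\pm\tfrac12)],$$ for any choice of the signs in $\xi$; $\delta u^3,\delta v^3$ are formal symbols and only the coefficients $A,B$ matter.
   Formalization: For arbitrary D the claim fails (two distant unit squares break uniqueness, a ring of squares breaks existence), so D is assumed to be a connected, simply connected union of unit squares, unpinched at vertices, each edge bounding a square; the equations are imposed at interior vertices. *)

theory Defs
  imports "HOL-Analysis.Analysis"
begin

text \<open>
  Discrete functions are curried and half-integer labels are rounded down: in a direction in which
  a label is shifted by 1/2, its lower integer neighbour is used.  Thus \<^term>\<open>F u v\<close> stands for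
  the value of \<^term>\<open>F\<close> at (u+1/2, v+1/2), i.e. on the unit square with lower-left vertex (u,v).
\<close>

definition diff1 :: "(int \<Rightarrow> int \<Rightarrow> 'a::ab_group_add) \<Rightarrow> int \<Rightarrow> int \<Rightarrow> 'a" where
  "diff1 f u v = f (u + 1) v - f u v"

definition diff2 :: "(int \<Rightarrow> int \<Rightarrow> 'a::ab_group_add) \<Rightarrow> int \<Rightarrow> int \<Rightarrow> 'a" where
  "diff2 f u v = f u (v + 1) - f u v"

definition diff12 :: "(int \<Rightarrow> int \<Rightarrow> 'a::ab_group_add) \<Rightarrow> int \<Rightarrow> int \<Rightarrow> 'a" where
  "diff12 f u v = f (u + 1) (v + 1) + f u v - f (u + 1) v - f u (v + 1)"

definition det3 :: "real^3 \<Rightarrow> real^3 \<Rightarrow> real^3 \<Rightarrow> real" where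
  "det3 a b c = det (vector [a, b, c] :: real^3^3)"


subsection \<open>Domains\<close>

definition corners :: "int \<times> int \<Rightarrow> (int \<times> int) set" where
  "corners s = {fst s, fst s + 1} \<times> {snd s, snd s + 1}"

text \<open>Unit squares are named by their lower-left vertex.\<close>

definition squares :: "(int \<times> int) set \<Rightarrow> (int \<times> int) set" where
  "squares D = {s. corners s \<subseteq> D}"

definition interior_vertex :: "(int \<times> int) set \<Rightarrow> int \<Rightarrow> int \<Rightarrow> bool" where
  "interior_vertex D u v \<longleftrightarrow> {u - 1, u} \<times> {v - 1, v} \<subseteq> squares D"

definition share_edge :: "int \<times> int \<Rightarrow> int \<times> int \<Rightarrow> bool" where
  "share_edge s t \<longleftrightarrow> \<bar>fst s - fst t\<bar> + \<bar>snd s - snd t\<bar> = 1"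

definition chain :: "(int \<times> int) set \<Rightarrow> (int \<times> int) list \<Rightarrow> bool" where
  "chain D ss \<longleftrightarrow> ss \<noteq> [] \<and> set ss \<subseteq> squares D \<and> successively share_edge ss"

text \<open>
  Homotopy of chains of squares: two chains with the same ends are identified if one is
  obtained from the other by removing or inserting back-and-forth steps and by passing an
  interior vertex on its other side (in rule \<open>turn\<close>, s and r are opposite squares at a vertex,
  so that t and t' can only be the remaining two squares at this vertex).
\<close>

inductive chain_homotopic :: "(int \<times> int) set \<Rightarrow> (int \<times> int) list \<Rightarrow> (int \<times> int) list \<Rightarrow> bool"
  for D where
  refl: "chain D ss \<Longrightarrow> chain_homotopic D ss ss"
| sym: "chain_homotopic D ss ts \<Longrightarrow> chain_homotopic D ts ss"
| trans: "chain_homotopic D rs ss \<Longrightarrow> chain_homotopic D ss ts \<Longrightarrow> chain_homotopic D rs ts"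
| spur: "chain D (xs @ [s, t, s] @ ys) \<Longrightarrow>
    chain_homotopic D (xs @ [s, t, s] @ ys) (xs @ [s] @ ys)"
| turn: "chain D (xs @ [s, t, r] @ ys) \<Longrightarrow> chain D (xs @ [s, t', r] @ ys) \<Longrightarrow>
    \<bar>fst s - fst r\<bar> = 1 \<Longrightarrow> \<bar>snd s - snd r\<bar> = 1 \<Longrightarrow>
    chain_homotopic D (xs @ [s, t, r] @ ys) (xs @ [s, t', r] @ ys)"

text \<open>
  Neither existence nor uniqueness can hold on an arbitrary subset of the lattice (consider
  separate components, holes, isolated points, edges that bound no square).  A domain is
  therefore a connected and simply connected union of unit squares which is not pinched
  at a vertex, i.e. the unit squares around any vertex are consecutive.  By
  \<open>simply_connected_domain_rectangle\<close> below this includes the plane and all rectangles,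
  finite or not.
\<close>

definition simply_connected_domain :: "(int \<times> int) set \<Rightarrow> bool" where
  "simply_connected_domain D \<longleftrightarrow>
    (\<forall>p\<in>D. \<exists>s\<in>squares D. p \<in> corners s) \<and>
    (\<forall>p\<in>D. \<forall>p'\<in>D. share_edge p p' \<longrightarrow> (\<exists>s\<in>squares D. {p, p'} \<subseteq> corners s)) \<and>
    (\<forall>s\<in>squares D. \<forall>r\<in>squares D. \<bar>fst s - fst r\<bar> = 1 \<and> \<bar>snd s - snd r\<bar> = 1 \<longrightarrow>
      (\<exists>t\<in>squares D. share_edge s t \<and> share_edge t r)) \<and>
    (\<forall>s\<in>squares D. \<forall>t\<in>squares D. \<exists>ss. chain D ss \<and> hd ss = s \<and> last ss = t) \<and>
    (\<forall>ss ts. chain D ss \<and> chain D ts \<and> hd ss = hd ts \<and> last ss = last ts \<longrightarrow>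
      chain_homotopic D ss ts)"

definition ipath :: "int \<Rightarrow> int \<Rightarrow> int list" where
  "ipath a b = (if a \<le> b then [a..b] else rev [b..a])"

definition Lpath :: "int \<times> int \<Rightarrow> int \<times> int \<Rightarrow> (int \<times> int) list" where
  "Lpath s t = map (\<lambda>x. (x, snd s)) (butlast (ipath (fst s) (fst t))) @
     map (Pair (fst t)) (ipath (snd s) (snd t))"

lemma ipath_ends: "ipath a b \<noteq> []" "hd (ipath a b) = a" "last (ipath a b) = b"
  by (auto simp: ipath_def hd_rev last_rev upto.simps[of a b] upto.simps[of b a] upto_rec2)

lemma set_ipath: "set (ipath a b) = {min a b..max a b}"
  by (auto simp: ipath_def)

lemma ipath_snoc: "\<bar>c - b\<bar> = 1 \<Longrightarrow> ipath a c = ipath a b @ [c] \<or> ipath a b = ipath a c @ [b]"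
proof -
  assume "\<bar>c - b\<bar> = 1"
  then consider "c = b + 1" | "b = c + 1" by linarith
  then show ?thesis
  proof cases
    case 1
    then show ?thesis
      by (cases "a \<le> b"; cases "a = c") 
        (auto simp: ipath_def upto_rec2[of a "b+1"] upto.simps[of b a] upto.simps[of b "b+1"])
  next
    case 2
    then show ?thesis
      by (cases "a \<le> c"; cases "a = b") 
        (auto simp: ipath_def upto_rec2[of a "c+1"] upto.simps[of c a] upto.simps[of c "c+1"])
  qed
qed

lemma successively_ipath: "successively (\<lambda>x y. \<bar>x - y\<bar> = 1) (ipath a b)"
proof -
  have up: "successively (\<lambda>x y. \<bar>x - y\<bar> = 1) [a..b]" for a b :: int
  proof (induction a b rule: upto.induct)
    case (1 a b)
    then show ?case
      by (cases "a + 1 \<le> b")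
        (auto simp: upto.simps[of a b] upto.simps[of "a + 1" b])
  qed
  show ?thesis
    using up[of a b] up[of b a]
    by (auto simp: ipath_def abs_minus_commute)
qed

lemma ipath_butlast: "ipath a b = butlast (ipath a b) @ [b]"
  by (metis append_butlast_last_id ipath_ends(1,3))

lemma Lpath_ends: "Lpath s t \<noteq> []" "hd (Lpath s t) = s" "last (Lpath s t) = t"
proof -
  have "hd (Lpath s t) = s"
  proof (cases "butlast (ipath (fst s) (fst t)) = []")
    case True
    then have "fst s = fst t"
      by (metis append_Nil ipath_butlast ipath_ends(2) list.sel(1))
    with True show ?thesis
      by (simp add: Lpath_def hd_map ipath_ends prod_eq_iff)
  next
    case False
    then have "hd (butlast (ipath (fst s) (fst t))) = fst s"
      by (metis hd_append2 ipath_butlast ipath_ends(2))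
    with False show ?thesis
      by (simp add: Lpath_def hd_map)
  qed
  then show "Lpath s t \<noteq> []" "hd (Lpath s t) = s" "last (Lpath s t) = t"
    by (simp_all add: Lpath_def last_map ipath_ends)
qed

lemma chain_snoc:
  "xs \<noteq> [] \<Longrightarrow> chain D (xs @ [t]) \<longleftrightarrow> chain D xs \<and> t \<in> squares D \<and> share_edge (last xs) t"
  by (auto simp: chain_def successively_append_iff)

lemma chain_homotopic_ends:
  "chain_homotopic D ss ts \<Longrightarrow> chain D ss \<and> chain D ts \<and> last ss = last ts"
proof (induction rule: chain_homotopic.induct)
  case (spur xs s t ys)
  then show ?case
    by (cases xs rule: rev_cases) (auto simp: chain_def successively_append_iff successively_Cons)
qed auto

lemma chain_homotopic_snoc:
  "chain_homotopic D ss ts \<Longrightarrow> chain D (ss @ [t]) \<Longrightarrow> chain_homotopic D (ss @ [t]) (ts @ [t])"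
proof (induction rule: chain_homotopic.induct)
  case (refl ss)
  then show ?case by (intro chain_homotopic.refl)
next
  case (sym ss ts)
  then show ?case
    by (metis chain_def chain_homotopic.sym chain_homotopic_ends chain_snoc)
next
  case (trans rs ss ts)
  then show ?case
    by (metis chain_def chain_homotopic.trans chain_homotopic_ends chain_snoc)
next
  case (spur xs a b ys)
  then show ?case
    using chain_homotopic.spur[of D xs a b "ys @ [t]"] by simp
next
  case (turn xs a b c ys b')
  then have "chain D ((xs @ [a, b', c] @ ys) @ [t])"
    by (subst chain_snoc) (auto simp: chain_snoc[of "xs @ [a, b, c] @ ys", simplified] split: if_splits)
  with turn show ?case
    using chain_homotopic.turn[of D xs a b c "ys @ [t]" b'] by simp
qed

lemma chain_Lpath:
  assumes "squares D = I \<times> J"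
    and conv: "\<And>x y. x \<in> I \<Longrightarrow> y \<in> I \<Longrightarrow> {x..y} \<subseteq> I" "\<And>x y. x \<in> J \<Longrightarrow> y \<in> J \<Longrightarrow> {x..y} \<subseteq> J"
    and "s \<in> squares D" "t \<in> squares D"
  shows "chain D (Lpath s t)"
proof -
  obtain a b c d where st: "s = (a, b)" "t = (c, d)" by fastforce
  define zs where "zs = butlast (ipath a c)"
  have zs: "ipath a c = zs @ [c]"
    unfolding zs_def by (rule ipath_butlast)
  have mem: "a \<in> I" "c \<in> I" "b \<in> J" "d \<in> J"
    using assms st by auto
  have "set (zs @ [c]) \<subseteq> I"
    using conv(1)[of a c] conv(1)[of c a] mem
    unfolding zs[symmetric] set_ipath by (simp add: min_def max_def split: if_splits)
  moreover have "set (ipath b d) \<subseteq> J"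
    using conv(2)[of b d] conv(2)[of d b] mem
    unfolding set_ipath by (simp add: min_def max_def split: if_splits)
  moreover have "successively (\<lambda>x y. \<bar>x - y\<bar> = 1) (zs @ [c])"
    unfolding zs[symmetric] by (rule successively_ipath)
  ultimately show ?thesis
    using mem successively_ipath[of b d] assms(1) ipath_ends[of b d]
    by (cases "zs = []") (auto simp: chain_def Lpath_def st zs_def[symmetric] successively_append_iff
        successively_map share_edge_def hd_map last_map)
qed

lemma chain_homotopic_column:
  assumes "squares D = I \<times> J" "c' \<in> I" "\<bar>c' - c\<bar> = 1"
    and "chain D (xs @ map (Pair c) (y # ys) @ [(c', last (y # ys))])"
  shows "chain_homotopic D (xs @ map (Pair c) (y # ys) @ [(c', last (y # ys))])
    (xs @ [(c, y)] @ map (Pair c') (y # ys))"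
  using assms(4)
proof (induction ys arbitrary: xs y)
  case Nil
  then show ?case by (simp add: chain_homotopic.refl)
next
  case (Cons z ys)
  have "chain_homotopic D (xs @ map (Pair c) (y # z # ys) @ [(c', last (y # z # ys))])
      (xs @ [(c, y), (c, z), (c', z)] @ map (Pair c') ys)" (is "chain_homotopic D ?l ?m")
    using Cons.IH[of "xs @ [(c, y)]" z] Cons.prems by simp
  moreover have "chain D ?m"
    using calculation chain_homotopic_ends by blast
  moreover have "chain D (xs @ [(c, y), (c', y), (c', z)] @ map (Pair c') ys)"
    using \<open>chain D ?m\<close> assms(1-3)
    by (auto simp: chain_def successively_append_iff successively_Cons share_edge_def)
  ultimately have "chain_homotopic D ?m (xs @ [(c, y), (c', y), (c', z)] @ map (Pair c') ys)"
    using assms(3)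
    by (intro chain_homotopic.turn) 
       (auto simp: chain_def successively_append_iff successively_Cons share_edge_def)
  with \<open>chain_homotopic D ?l ?m\<close> show ?case
    using chain_homotopic.trans by fastforce
qed

lemma chain_homotopic_Lpath_snoc:
  assumes sq: "squares D = I \<times> J"
    and conv: "\<And>x y. x \<in> I \<Longrightarrow> y \<in> I \<Longrightarrow> {x..y} \<subseteq> I" "\<And>x y. x \<in> J \<Longrightarrow> y \<in> J \<Longrightarrow> {x..y} \<subseteq> J"
    and s: "s \<in> squares D" and ch: "chain D (Lpath s t @ [t'])"
  shows "chain_homotopic D (Lpath s t @ [t']) (Lpath s t')"
proof -
  obtain a b c d where st: "s = (a, b)" "t = (c, d)" by fastforce
  obtain c' d' where t': "t' = (c', d')" by fastforce
  have "chain D (Lpath s t)" and t'in: "t' \<in> squares D" and e: "share_edge t t'"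
    using ch Lpath_ends[of s t] by (auto simp: chain_snoc)
  define xs where "xs = map (\<lambda>x. (x, b)) (butlast (ipath a c))"
  from e consider "c' = c" "\<bar>d' - d\<bar> = 1" | "d' = d" "\<bar>c' - c\<bar> = 1"
    unfolding share_edge_def st t' by fastforce
  then show ?thesis
  proof cases
    case 1
    from ipath_snoc[OF 1(2), of b] show ?thesis
    proof
      assume "ipath b d' = ipath b d @ [d']"
      then have "Lpath s t @ [t'] = Lpath s t'"
        by (simp add: Lpath_def st t' 1)
      then show ?thesis
        using ch chain_homotopic.refl by metis
    next
      assume r: "ipath b d = ipath b d' @ [d]"
      define ws where "ws = butlast (ipath b d')"
      have ws: "ipath b d' = ws @ [d']"
        unfolding ws_def by (rule ipath_butlast)
      have "Lpath s t @ [t'] = (xs @ map (Pair c) ws) @ [t', t, t'] @ []"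
        "Lpath s t' = (xs @ map (Pair c) ws) @ [t'] @ []"
        by (simp_all add: Lpath_def st t' 1 r ws xs_def)
      then show ?thesis
        using ch chain_homotopic.spur by metis
    qed
  next
    case 2
    obtain ys where ys: "ipath b d = b # ys"
      using ipath_ends[of b d] by (cases "ipath b d") auto
    have last: "last (b # ys) = d"
      using ipath_ends(3)[of b d] ys by simp
    have l: "Lpath s t @ [t'] = xs @ map (Pair c) (b # ys) @ [(c', last (b # ys))]"
      unfolding last by (simp add: Lpath_def st t' xs_def ys 2)
    have col: "chain_homotopic D (Lpath s t @ [t']) (xs @ [(c, b)] @ map (Pair c') (b # ys))"
      unfolding l by (rule chain_homotopic_column[OF sq]) (use 2 t'in sq t' ch l in auto)
    from ipath_snoc[OF 2(2), of a] show ?thesis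
    proof
      assume r: "ipath a c' = ipath a c @ [c']"
      have "Lpath s t' = xs @ [(c, b)] @ map (Pair c') (b # ys)"
        using arg_cong[OF ipath_butlast[of a c], of "map (\<lambda>x. (x, b))"]
        by (simp add: Lpath_def st t' 2 r ys xs_def del: map_butlast)
      then show ?thesis using col by simp
    next
      assume r: "ipath a c = ipath a c' @ [c]"
      define ws where "ws = butlast (ipath a c')"
      have ws: "ipath a c' = ws @ [c']"
        unfolding ws_def by (rule ipath_butlast)
      define zs where "zs = map (\<lambda>x. (x, b)) ws"
      have e1: "xs @ [(c, b)] @ map (Pair c') (b # ys)
          = zs @ [(c', b), (c, b), (c', b)] @ map (Pair c') ys"
        by (simp add: r ws xs_def zs_def butlast_append)
      have e2: "Lpath s t' = zs @ [(c', b)] @ map (Pair c') ys"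
        by (simp add: Lpath_def st t' 2 ws zs_def ys)
      have "chain D (zs @ [(c', b), (c, b), (c', b)] @ map (Pair c') ys)"
        using chain_homotopic_ends[OF col] unfolding e1 by blast
      from chain_homotopic.trans[OF col[unfolded e1] chain_homotopic.spur[OF this]]
      show ?thesis
        unfolding e2 .
    qed
  qed
qed

lemma simply_connected_domain_rectangle:
  assumes conv: "\<And>x y. x \<in> I \<Longrightarrow> y \<in> I \<Longrightarrow> {x..y} \<subseteq> I" "\<And>x y. x \<in> J \<Longrightarrow> y \<in> J \<Longrightarrow> {x..y} \<subseteq> J"
    and two: "x1 \<in> I" "x2 \<in> I" "x1 \<noteq> x2" "y1 \<in> J" "y2 \<in> J" "y1 \<noteq> y2"
  shows "simply_connected_domain (I \<times> J)"
proof -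
  define D I' J' where "D = I \<times> J" and "I' = {u. u \<in> I \<and> u + 1 \<in> I}" and "J' = {v. v \<in> J \<and> v + 1 \<in> J}"
  have sq: "squares D = I' \<times> J'"
    by (auto simp: squares_def corners_def D_def I'_def J'_def)
  have conv': "{x..y} \<subseteq> I'" if "x \<in> I'" "y \<in> I'" for x y
    using that conv(1)[of x "y + 1"] by (auto simp: I'_def)
  have conv'': "{x..y} \<subseteq> J'" if "x \<in> J'" "y \<in> J'" for x y
    using that conv(2)[of x "y + 1"] by (auto simp: J'_def)
  have nbr: "u \<in> K \<and> u + 1 \<in> K \<or> u - 1 \<in> K \<and> u \<in> K"
    if h: "u \<in> K" "a \<in> K" "b \<in> K" "a \<noteq> b" and hconv: "\<And>x y. x \<in> K \<Longrightarrow> y \<in> K \<Longrightarrow> {x..y} \<subseteq> K" for u a b :: int and K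
  proof -
    obtain w where w: "w \<in> K" "w \<noteq> u" using h by (cases "u = a") auto
    show ?thesis
    proof (cases "u < w")
      case True
      then have "u + 1 \<in> {u..w}" by simp
      then show ?thesis using h(1) hconv[of u w] w by blast
    next
      case False
      then have "u - 1 \<in> {w..u}" using w by simp
      then show ?thesis using h(1) hconv[of w u] w by blast
    qed
  qed
  have fI: "u \<in> I' \<or> u - 1 \<in> I'" if "u \<in> I" for u
    using nbr[OF that two(1-3) conv(1)] by (auto simp: I'_def)
  have fJ: "v \<in> J' \<or> v - 1 \<in> J'" if "v \<in> J" for v
    using nbr[OF that two(4-6) conv(2)] by (auto simp: J'_def)
  have L: "chain_homotopic D ss (Lpath (hd ss) (last ss))" if "chain D ss" for ss
    using that
  proof (induction ss rule: rev_induct)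
    case Nil
    then show ?case by (simp add: chain_def)
  next
    case (snoc t ss)
    show ?case
    proof (cases "ss = []")
      case True
      have "Lpath t t = [t]"
        by (simp add: Lpath_def ipath_def)
      with True snoc.prems show ?thesis
        by (simp add: chain_homotopic.refl)
    next
      case False
      then have c: "chain D ss"
        using snoc.prems by (simp add: chain_snoc)
      have 1: "chain_homotopic D (ss @ [t]) (Lpath (hd ss) (last ss) @ [t])"
        using chain_homotopic_snoc[OF snoc.IH[OF c] snoc.prems] .
      have "hd ss \<in> squares D"
        using c by (auto simp: chain_def)
      then have "chain_homotopic D (Lpath (hd ss) (last ss) @ [t]) (Lpath (hd ss) t)"
        using chain_homotopic_Lpath_snoc[OF sq conv' conv''] 1 chain_homotopic_ends by blast
      with 1 False show ?thesis
        using chain_homotopic.trans by fastforce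
    qed
  qed
  have A: "\<forall>p\<in>D. \<exists>s\<in>squares D. p \<in> corners s"
  proof
    fix p assume "p \<in> D"
    then obtain u v where p: "p = (u, v)" "u \<in> I" "v \<in> J" by (auto simp: D_def)
    obtain u' where "u' \<in> I'" "u = u' \<or> u = u' + 1" using fI[OF p(2)] by force
    moreover obtain v' where "v' \<in> J'" "v = v' \<or> v = v' + 1" using fJ[OF p(3)] by force
    ultimately show "\<exists>s\<in>squares D. p \<in> corners s"
      by (intro bexI[of _ "(u', v')"]) (auto simp: sq corners_def p)
  qed
  have B: "\<exists>s\<in>squares D. {p, p'} \<subseteq> corners s" if pD: "p \<in> D" "p' \<in> D" "share_edge p p'" for p p'
  proof -
    obtain u v where p: "p = (u, v)" "u \<in> I" "v \<in> J" using pD by (auto simp: D_def)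
    obtain u2 v2 where p': "p' = (u2, v2)" "u2 \<in> I" "v2 \<in> J" using pD by (auto simp: D_def)
    have "u2 = u \<and> \<bar>v2 - v\<bar> = 1 \<or> v2 = v \<and> \<bar>u2 - u\<bar> = 1"
      using pD(3) unfolding p p' share_edge_def by fastforce
    then show ?thesis
    proof
      assume h: "u2 = u \<and> \<bar>v2 - v\<bar> = 1"
      obtain u' where "u' \<in> I'" "u = u' \<or> u = u' + 1" using fI[OF p(2)] by force
      moreover have J2: "v2 = v + 1 \<or> v = v2 + 1"
        using h by linarith
      moreover have "min v v2 \<in> J'"
        using J2 h p p' by (cases "v \<le> v2") (auto simp: J'_def min_def abs_if algebra_simps)
      ultimately show ?thesis
        using h by (intro bexI[of _ "(u', min v v2)"]) (auto simp: sq corners_def p p' min_def)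
    next
      assume h: "v2 = v \<and> \<bar>u2 - u\<bar> = 1"
      obtain v' where "v' \<in> J'" "v = v' \<or> v = v' + 1" using fJ[OF p(3)] by force
      moreover have J2: "u2 = u + 1 \<or> u = u2 + 1"
        using h by linarith
      moreover have "min u u2 \<in> I'"
        using J2 h p p' by (cases "u \<le> u2") (auto simp: I'_def min_def abs_if algebra_simps)
      ultimately show ?thesis
        using h by (intro bexI[of _ "(min u u2, v')"]) (auto simp: sq corners_def p p' min_def)
    qed
  qed
  have C: "\<exists>t\<in>squares D. share_edge s t \<and> share_edge t r"
    if "s \<in> squares D" "r \<in> squares D" "\<bar>fst s - fst r\<bar> = 1" "\<bar>snd s - snd r\<bar> = 1" for s r
    using that by (intro bexI[of _ "(fst s, snd r)"]) (auto simp: sq share_edge_def)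
  have "\<exists>ss. chain D ss \<and> hd ss = s \<and> last ss = t" if "s \<in> squares D" "t \<in> squares D" for s t
    using chain_Lpath[OF sq conv' conv'' that] Lpath_ends by blast
  moreover have "chain_homotopic D ss ts"
    if "chain D ss" "chain D ts" "hd ss = hd ts" "last ss = last ts" for ss ts
    using L[OF that(1)] L[OF that(2)] that chain_homotopic.sym chain_homotopic.trans by metis
  ultimately have "simply_connected_domain D"
    unfolding simply_connected_domain_def using A B C by (intro conjI) blast+
  then show ?thesis by (simp add: D_def)
qed

corollary simply_connected_domain_UNIV: "simply_connected_domain UNIV"
  using simply_connected_domain_rectangle[of UNIV UNIV 0 1 0 1] by simp


subsection \<open>Affine minimal surfaces and their quadratic and cubic forms\<close>

definition conormal_metric :: "(int \<Rightarrow> int \<Rightarrow> real^3) \<Rightarrow> int \<Rightarrow> int \<Rightarrow> real" where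
  "conormal_metric \<nu> u v = \<nu> u v \<bullet> cross3 (\<nu> u (v + 1)) (\<nu> (u + 1) v)"

definition conormal_map :: "(int \<times> int) set \<Rightarrow> (int \<Rightarrow> int \<Rightarrow> real^3) \<Rightarrow> bool" where
  "conormal_map D \<nu> \<longleftrightarrow>
    (\<forall>u v. (u, v) \<in> squares D \<longrightarrow> diff12 \<nu> u v = 0 \<and> conormal_metric \<nu> u v > 0)"

definition conormal_map_of ::
    "(int \<times> int) set \<Rightarrow> (int \<Rightarrow> int \<Rightarrow> real^3) \<Rightarrow> (int \<Rightarrow> int \<Rightarrow> real^3) \<Rightarrow> bool" where
  "conormal_map_of D q \<nu> \<longleftrightarrow> conormal_map D \<nu> \<and>
    (\<forall>u v. (u, v) \<in> D \<and> (u + 1, v) \<in> D \<longrightarrow> diff1 q u v = cross3 (\<nu> u v) (\<nu> (u + 1) v)) \<and>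
    (\<forall>u v. (u, v) \<in> D \<and> (u, v + 1) \<in> D \<longrightarrow> diff2 q u v = - cross3 (\<nu> u v) (\<nu> u (v + 1)))"

definition affine_minimal_surface :: "(int \<times> int) set \<Rightarrow> (int \<Rightarrow> int \<Rightarrow> real^3) \<Rightarrow> bool" where
  "affine_minimal_surface D q \<longleftrightarrow> (\<exists>\<nu>. conormal_map_of D q \<nu>)"

definition has_quadratic_form ::
    "(int \<times> int) set \<Rightarrow> (int \<Rightarrow> int \<Rightarrow> real^3) \<Rightarrow> (int \<Rightarrow> int \<Rightarrow> real) \<Rightarrow> bool" where
  "has_quadratic_form D q F \<longleftrightarrow>
    (\<exists>\<nu>. conormal_map_of D q \<nu> \<and> (\<forall>u v. (u, v) \<in> squares D \<longrightarrow> conormal_metric \<nu> u v = F u v))"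

text \<open>
  \<^term>\<open>F\<close> is the affine metric of \<^term>\<open>q\<close>.  It does not depend on the choice of the co-normal map,
  see \<open>has_quadratic_form_unique\<close> below.
\<close>

definition affine_normal ::
    "(int \<Rightarrow> int \<Rightarrow> real^3) \<Rightarrow> (int \<Rightarrow> int \<Rightarrow> real) \<Rightarrow> int \<Rightarrow> int \<Rightarrow> real^3" where
  "affine_normal q F u v = diff12 q u v /\<^sub>R F u v"

text \<open>
  A coefficient of the cubic form is prescribed at the vertices where the edges in its definition
  exist, for each square s of the domain at that vertex (the choice of signs in the affine normal).
\<close>

definition has_cubic_form ::
    "(int \<times> int) set \<Rightarrow> (int \<Rightarrow> int \<Rightarrow> real^3) \<Rightarrow> (int \<Rightarrow> int \<Rightarrow> real) \<Rightarrow>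
      (int \<Rightarrow> int \<Rightarrow> real) \<Rightarrow> (int \<Rightarrow> int \<Rightarrow> real) \<Rightarrow> bool" where
  "has_cubic_form D q F A B \<longleftrightarrow>
    (\<forall>u v. \<forall>s\<in>squares D. (u, v) \<in> corners s \<longrightarrow>
      ((u - 1, v) \<in> D \<and> (u + 1, v) \<in> D \<longrightarrow>
        A u v = det3 (diff1 q (u - 1) v) (diff1 q u v) (affine_normal q F (fst s) (snd s))) \<and>
      ((u, v - 1) \<in> D \<and> (u, v + 1) \<in> D \<longrightarrow>
        B u v = det3 (diff2 q u v) (diff2 q u (v - 1)) (affine_normal q F (fst s) (snd s))))"

definition affine_equivalent ::
    "(int \<times> int) set \<Rightarrow> (int \<Rightarrow> int \<Rightarrow> real^3) \<Rightarrow> (int \<Rightarrow> int \<Rightarrow> real^3) \<Rightarrow> bool" where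
  "affine_equivalent D q q' \<longleftrightarrow>
    (\<exists>(M :: real^3^3) b. invertible M \<and> (\<forall>u v. (u, v) \<in> D \<longrightarrow> q' u v = M *v q u v + b))"

lemma conormal_metric_square:
  assumes "conormal_map_of D q \<nu>" "(u, v) \<in> squares D"
  shows "(conormal_metric \<nu> u v)\<^sup>2 = det3 (diff1 q u v) (diff2 q u v) (diff12 q u v)"
proof -
  have D: "(u, v) \<in> D" "(u + 1, v) \<in> D" "(u, v + 1) \<in> D" "(u + 1, v + 1) \<in> D"
    using assms(2) by (auto simp: squares_def corners_def)
  have "diff12 q u v = diff1 q u (v + 1) - diff1 q u v"
    by (simp add: diff12_def diff1_def)
  then have q12: "diff12 q u v = cross3 (\<nu> u (v + 1)) (\<nu> (u + 1) (v + 1)) - cross3 (\<nu> u v) (\<nu> (u + 1) v)"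
    using assms(1) D by (simp add: conormal_map_of_def)
  have "diff12 \<nu> u v = 0"
    using assms unfolding conormal_map_of_def conormal_map_def by blast
  then have "\<nu> (u + 1) (v + 1) = \<nu> (u + 1) v + \<nu> u (v + 1) - \<nu> u v"
    by (simp add: diff12_def algebra_simps)
  moreover have "diff1 q u v = cross3 (\<nu> u v) (\<nu> (u + 1) v)"
    "diff2 q u v = - cross3 (\<nu> u v) (\<nu> u (v + 1))"
    using assms(1) D by (simp_all add: conormal_map_of_def)
  moreover have "(a \<bullet> cross3 c b)\<^sup>2 =
      det3 (cross3 a b) (- cross3 a c) (cross3 c (b + c - a) - cross3 a b)" for a b c :: "real^3"
    unfolding det3_def det_3 cross3_def inner_vec_def sum_3
    by (simp add: vector_3) algebra
  ultimately show ?thesis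
    unfolding q12 conormal_metric_def by simp
qed

lemma has_quadratic_form_unique:
  assumes "has_quadratic_form D q F" "has_quadratic_form D q G" "(u, v) \<in> squares D"
  shows "F u v = G u v"
proof -
  obtain \<mu> where \<mu>: "conormal_map_of D q \<mu>" "conormal_metric \<mu> u v = F u v"
    using assms(1,3) unfolding has_quadratic_form_def by blast
  obtain \<nu> where \<nu>: "conormal_map_of D q \<nu>" "conormal_metric \<nu> u v = G u v"
    using assms(2,3) unfolding has_quadratic_form_def by blast
  have pos: "conormal_metric \<rho> u v > 0" if "conormal_map_of D q \<rho>" for \<rho>
    using that assms(3) unfolding conormal_map_of_def conormal_map_def by blast
  have "(F u v)\<^sup>2 = (G u v)\<^sup>2"
    using conormal_metric_square[OF \<mu>(1) assms(3)] conormal_metric_square[OF \<nu>(1) assms(3)] \<mu>(2) \<nu>(2)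
    by simp
  moreover have "F u v > 0" "G u v > 0"
    using pos[OF \<mu>(1)] pos[OF \<nu>(1)] \<mu>(2) \<nu>(2) by simp_all
  ultimately show ?thesis
    by (simp add: power2_eq_iff)
qed

end

theory Submission
  imports Defs
begin

text \<open>
  Since the co-normals at the vertices of a square span space and pair to 1 with the affine normal,
  the coefficients of the cubic form are determinants of three consecutive co-normals on a lattice
  line.  Hence F, A and B determine the co-normals of a square linearly from those of a neighbouring
  square, the position being carried along by cross products.  The compatibility equations say that
  these transitions have trivial holonomy around interior vertices, so on a simply connected domain
  one square determines the surface, and any state of that square with the right metric extends.
  The transitions commute with unimodular linear maps of the co-normals, which induce affine maps of
  the positions; as two initial states with equal metric differ by such a map, so do the surfaces.
\<close>

subsection \<open>Transport along chains of squares\<close>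

lemma corners_iff [simp]: "(x, y) \<in> corners (u, v) \<longleftrightarrow> (x = u \<or> x = u + 1) \<and> (y = v \<or> y = v + 1)"
  by (auto simp: corners_def)

lemma share_edge_cases:
  assumes "share_edge s t"
  obtains (right) u v where "s = (u, v)" "t = (u + 1, v)"
    | (left) u v where "s = (u + 1, v)" "t = (u, v)"
    | (up) u v where "s = (u, v)" "t = (u, v + 1)"
    | (down) u v where "s = (u, v + 1)" "t = (u, v)"
proof -
  obtain a b c d where st: "s = (a, b)" "t = (c, d)" by fastforce
  have "c = a + 1 \<and> d = b \<or> a = c + 1 \<and> d = b \<or> c = a \<and> d = b + 1 \<or> c = a \<and> b = d + 1"
    using assms unfolding share_edge_def st by auto
  then show ?thesis
    using that unfolding st by blast
qed

lemma share_edge_commute: "share_edge s t \<longleftrightarrow> share_edge t s"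
  by (simp add: share_edge_def abs_minus_commute)

lemma common_neighbour:
  assumes "share_edge s t" "share_edge t r" "\<bar>fst s - fst r\<bar> = 1" "\<bar>snd s - snd r\<bar> = 1"
  shows "t = (fst s, snd r) \<or> t = (fst r, snd s)"
  using assms(1)
proof (cases rule: share_edge_cases)
qed (use assms(2-4) in \<open>cases r, auto simp: share_edge_def abs_if split: if_splits\<close>)

text \<open>Parallel transport: \<open>T\<close> is applied across each consecutive pair of squares,
  starting at the head. The clause for \<open>[]\<close> is only a default value, since chains are
  nonempty.\<close>

fun transport :: "('s \<Rightarrow> 's \<Rightarrow> 'a \<Rightarrow> 'a) \<Rightarrow> 's list \<Rightarrow> 'a \<Rightarrow> 'a" where
  "transport T (s # t # ss) x = transport T (t # ss) (T s t x)"
| "transport T [s] x = x"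
| "transport T [] x = x"

text \<open>The square \<open>s\<close> occurs on both lists because transport acts on pairs: the
  pair ending in \<open>s\<close> belongs to the first list, the pair starting with \<open>s\<close>
  to the second.\<close>

lemma transport_append:
  "transport T (xs @ s # ys) x = transport T (s # ys) (transport T (xs @ [s]) x)"
  by (induction T xs x rule: transport.induct) auto

text \<open>An invertible flat connection on the squares: \<open>commute\<close> expresses trivial
  holonomy around an interior vertex. It is stated for the lower left starting square only;
  \<open>inverse\<close> yields the other three starting squares in
  \<open>transport_turn\<close>.\<close>

locale square_transport =
  fixes D :: "(int \<times> int) set" and T :: "int \<times> int \<Rightarrow> int \<times> int \<Rightarrow> 'a \<Rightarrow> 'a"
  assumes simply_connected: "simply_connected_domain D"
    and inverse: "s \<in> squares D \<Longrightarrow> t \<in> squares D \<Longrightarrow> share_edge s t \<Longrightarrow> T t s (T s t x) = x"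
    and commute: "{u, u + 1} \<times> {v, v + 1} \<subseteq> squares D \<Longrightarrow>
      T (u + 1, v) (u + 1, v + 1) (T (u, v) (u + 1, v) x) =
      T (u, v + 1) (u + 1, v + 1) (T (u, v) (u, v + 1) x)"
begin

lemma transport_turn:
  assumes sq: "s \<in> squares D" "t \<in> squares D" "t' \<in> squares D" "r \<in> squares D"
    and e: "share_edge s t" "share_edge t r" "share_edge s t'" "share_edge t' r"
    and d: "\<bar>fst s - fst r\<bar> = 1" "\<bar>snd s - snd r\<bar> = 1"
  shows "T t r (T s t x) = T t' r (T s t' x)"
proof (cases "t = t'")
  case False
  obtain a b c d where sr: "s = (a, b)" "r = (c, d)" by fastforce
  define u v where "u = min a c" and "v = min b d"
  have ac: "a = u \<and> c = u + 1 \<or> a = u + 1 \<and> c = u" and bd: "b = v \<and> d = v + 1 \<or> b = v + 1 \<and> d = v"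
    using d by (auto simp: sr u_def v_def min_def)
  have "t = (a, d) \<or> t = (c, b)" "t' = (a, d) \<or> t' = (c, b)"
    using common_neighbour[of s t r] common_neighbour[of s t' r] e d by (simp_all add: sr)
  with False have t: "t = (a, d) \<and> t' = (c, b) \<or> t = (c, b) \<and> t' = (a, d)"
    by auto
  let ?p = "(u, v)" and ?q = "(u + 1, v)" and ?r = "(u, v + 1)" and ?w = "(u + 1, v + 1)"
  have m: "?p \<in> squares D" "?q \<in> squares D" "?r \<in> squares D" "?w \<in> squares D"
    using sq t ac bd sr by auto
  have comm: "T ?q ?w (T ?p ?q x) = T ?r ?w (T ?p ?r x)" for x
    by (rule commute) (use m in auto)
  have i: "T ?q ?p (T ?p ?q x) = x" "T ?p ?q (T ?q ?p x) = x" "T ?r ?p (T ?p ?r x) = x"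
    "T ?p ?r (T ?r ?p x) = x" "T ?q ?w (T ?w ?q x) = x" "T ?w ?q (T ?q ?w x) = x"
    "T ?r ?w (T ?w ?r x) = x" "T ?w ?r (T ?r ?w x) = x" for x
    by (rule inverse; use m in \<open>simp add: share_edge_def\<close>)+
  \<comment> \<open>The relation \<open>comm\<close> starts at the lower left square. Cancelling
    with the inverses in \<open>i\<close> gives the relations that start at the upper right, lower
    right and upper left squares.\<close>
  have "T ?q ?p (T ?w ?q x) = T ?r ?p (T ?w ?r x)"
    by (metis comm i)
  moreover have "T ?p ?r (T ?q ?p x) = T ?w ?r (T ?q ?w x)"
    by (metis comm i)
  moreover have "T ?p ?q (T ?r ?p x) = T ?w ?q (T ?r ?w x)"
    by (metis comm i)
  ultimately show ?thesis
    using ac bd t comm[of x] unfolding sr by auto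
qed auto

text \<open>Rule by rule: \<open>inverse\<close> removes a spur, and \<open>transport_turn\<close>
  passes an interior vertex on its other side.\<close>

lemma transport_homotopic:
  "chain_homotopic D ss ts \<Longrightarrow> transport T ss x = transport T ts x"
proof (induction rule: chain_homotopic.induct)
  case (spur xs s t ys)
  then have "T t s (T s t y) = y" for y
    by (intro inverse) (auto simp: chain_def successively_append_iff successively_Cons)
  then show ?case
    by (simp add: transport_append[of T xs s "t # s # ys"] transport_append[of T xs s ys])
next
  case (turn xs s t r ys t')
  then have "T t r (T s t y) = T t' r (T s t' y)" for y
    by (intro transport_turn) (auto simp: chain_def successively_append_iff successively_Cons)
  then show ?case
    by (simp add: transport_append[of T xs s "t # r # ys"] transport_append[of T xs s "t' # r # ys"])
qed auto

text \<open>Choose a chain from \<open>s0\<close> to every square and transport \<open>x0\<close>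
  along it. The chain chosen for \<open>t\<close> is homotopic to the one chosen for
  \<open>s\<close> followed by \<open>t\<close>, so neighbouring values are related by
  \<open>T\<close>.\<close>

lemma ex_section:
  assumes s0: "s0 \<in> squares D"
  obtains \<Phi> where "\<Phi> s0 = x0"
    "\<And>s t. s \<in> squares D \<Longrightarrow> t \<in> squares D \<Longrightarrow> share_edge s t \<Longrightarrow> \<Phi> t = T s t (\<Phi> s)"
proof -
  have hom: "chain_homotopic D ss ts"
    if "chain D ss" "chain D ts" "hd ss = hd ts" "last ss = last ts" for ss ts
    using simply_connected that unfolding simply_connected_domain_def by blast
  define c where "c t = (SOME ss. chain D ss \<and> hd ss = s0 \<and> last ss = t)" for t
  have c: "chain D (c t)" "hd (c t) = s0" "last (c t) = t" if "t \<in> squares D" for t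
  proof -
    have "\<exists>ss. chain D ss \<and> hd ss = s0 \<and> last ss = t"
      using simply_connected that s0 unfolding simply_connected_domain_def by blast
    from someI_ex[OF this] show "chain D (c t)" "hd (c t) = s0" "last (c t) = t"
      unfolding c_def by auto
  qed
  show ?thesis
  proof
    \<comment> \<open>The chain chosen for \<open>s0\<close> itself may be a proper loop; it is
      contracted to the one-square chain.\<close>
    have "chain D [s0]"
      using s0 by (simp add: chain_def)
    then show "transport T (c s0) x0 = x0"
      using transport_homotopic[OF hom[of "c s0" "[s0]"]] c[OF s0] by simp
    fix s t assume st: "s \<in> squares D" "t \<in> squares D" "share_edge s t"
    have ne: "c s \<noteq> []"
      using c(1)[OF st(1)] by (simp add: chain_def)
    then have "chain D (c s @ [t])"
      using c[OF st(1)] st by (simp add: chain_snoc)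
    then have "transport T (c t) x0 = transport T (c s @ [t]) x0"
      using c[OF st(1)] c[OF st(2)] ne by (intro transport_homotopic hom) auto
    also have "c s = butlast (c s) @ [s]"
      using c(3)[OF st(1)] ne append_butlast_last_id by metis
    then have "transport T (c s @ [t]) x0 = T s t (transport T (c s) x0)"
      by (metis append.assoc append_Cons append_Nil transport.simps transport_append)
    finally show "transport T (c t) x0 = T s t (transport T (c s) x0)" .
  qed
qed

end

text \<open>Connectedness as an induction principle. It serves to propagate the metric of the states
  and the affine relation between two surfaces.\<close>

lemma squares_induct:
  assumes "simply_connected_domain D" "s0 \<in> squares D" "P s0"
    and step: "\<And>s t. s \<in> squares D \<Longrightarrow> t \<in> squares D \<Longrightarrow> share_edge s t \<Longrightarrow> P s \<Longrightarrow> P t"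
    and "t \<in> squares D"
  shows "P t"
proof -
  obtain ss where "chain D ss" "hd ss = s0" "last ss = t"
    using assms unfolding simply_connected_domain_def by blast
  moreover have "chain D ss \<Longrightarrow> hd ss = s0 \<Longrightarrow> P (last ss)"
  proof (induction ss rule: rev_induct)
    case (snoc t ss)
    show ?case
    proof (cases "ss = []")
      case True
      then show ?thesis using snoc.prems assms(3) by simp
    next
      case False
      then have "chain D ss" "t \<in> squares D" "share_edge (last ss) t" "hd ss = s0"
        using snoc.prems by (auto simp: chain_snoc)
      moreover have "last ss \<in> squares D"
        using \<open>chain D ss\<close> False by (auto simp: chain_def)
      ultimately show ?thesis
        using snoc.IH step by simp
    qed
  qed (simp add: chain_def)
  ultimately show ?thesis by blast
qed

subsection \<open>Transition between neighbouring squares\<close>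

text \<open>
  Let a, b, d and b, e, d be co-normals at consecutive vertices of two squares with common edge bd,
  where a and e continue each other through b.  The coefficients of e in the basis a, b, d follow by
  Cramer's rule from the metrics f, f' of the squares and from the cubic coefficients k at b and
  l at d.  Columns need all four numbers with the opposite sign, which does not change e.
\<close>

definition next_conormal ::
    "real \<Rightarrow> real \<Rightarrow> real \<Rightarrow> real \<Rightarrow> real^3 \<Rightarrow> real^3 \<Rightarrow> real^3 \<Rightarrow> real^3" where
  "next_conormal f f' k l a b d = (1 + (l + f') / f) *\<^sub>R b - (f' / f) *\<^sub>R a - (k / f) *\<^sub>R d"

text \<open>With e the next co-normal, the formula reads f e + f' a = (f + f' + l) b - k d, which is
  symmetric under exchanging a with e and f with f'.\<close>

lemma next_conormal_back:
  assumes "f \<noteq> 0" "f' \<noteq> 0"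
  shows "next_conormal f' f k l (next_conormal f f' k l a b d) b d = a"
  using assms by (simp add: vec_eq_iff next_conormal_def field_simps)

lemma det3_cross: "det3 a b c = cross3 a b \<bullet> c"
  unfolding det3_def det_3 cross3_def inner_vec_def sum_3 by (simp add: vector_3 algebra_simps)

lemma det3_diff: "det3 a b (x - y) = det3 a b x - det3 a b y"
  and det3_add: "det3 a b (x + y) = det3 a b x + det3 a b y"
  and det3_scale: "det3 a b (r *\<^sub>R x) = r * det3 a b x"
  by (simp_all add: det3_cross inner_diff_right inner_add_right)

text \<open>By the parallelogram relation, the co-normals on the parallel line through d are (a - b)
  + d, d and (e - b) + d. Their determinant, the cubic coefficient at d, is thus expressed in a, b,
  d and e.\<close>

lemma det3_shear: "det3 (x + d) d (y + d) = det3 x d y"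
  by (simp add: det3_def det_3 vector_3 algebra_simps)

lemma next_conormal_unique:
  assumes "f \<noteq> 0" "det3 a d b = f" "det3 b d e = f'" "det3 a b e = k" "det3 (a - b) d (e - b) = l"
  shows "e = next_conormal f f' k l a b d"
proof -
  \<comment> \<open>Cramer's rule for e in the basis a, b, d. The coefficient of b is
    \<open>det3 a d e\<close>, which expanding \<open>det3 (a - b) d (e - b)\<close> turns into the
    sum shown.\<close>
  have "det3 a d b *\<^sub>R e = (det3 a d b + (det3 (a - b) d (e - b) + det3 b d e)) *\<^sub>R b
     - det3 b d e *\<^sub>R a - det3 a b e *\<^sub>R d"
    unfolding vec_eq_iff forall_3 det3_def det_3
    by (intro conjI; simp add: vector_3; algebra)
  then have "f *\<^sub>R e = (f + (l + f')) *\<^sub>R b - f' *\<^sub>R a - k *\<^sub>R d"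
    unfolding assms by simp
  also have "\<dots> = f *\<^sub>R next_conormal f f' k l a b d"
    using assms(1) by (simp add: vec_eq_iff next_conormal_def field_simps)
  finally show ?thesis
    using assms(1) by simp
qed

text \<open>The converse of \<open>next_conormal_unique\<close>: by linearity in e, each determinant
  reduces to multiples of \<open>det3 a d b\<close>. It recovers the forms from the
  transitions.\<close>

lemma det3_next_conormal:
  fixes a b d :: "real^3" and f f' k l :: real
  defines "e \<equiv> next_conormal f f' k l a b d"
  assumes "f \<noteq> 0" "det3 a d b = f"
  shows "det3 b d e = f'" "det3 a b e = k" "det3 (a - b) d (e - b) = l"
proof -
  have z: "det3 b d b = 0" "det3 b d a = - det3 a d b" "det3 b d d = 0" "det3 a b a = 0" "det3 a b b = 0"
    "det3 a b d = - det3 a d b" "det3 (a - b) d b = det3 a d b" "det3 (a - b) d a = det3 a d b"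
    "det3 (a - b) d d = 0"
    by (simp_all add: det3_def det_3 vector_3 algebra_simps)
  show "det3 b d e = f'" "det3 a b e = k" "det3 (a - b) d (e - b) = l"
    using assms(2)
    by (simp_all add: e_def next_conormal_def det3_add det3_diff det3_scale z assms(3) field_simps)
qed

text \<open>
  Around an interior vertex d, both ways from the lower left to the upper right square give the same
  lower right co-normal there.  The other new co-normal is obtained by exchanging rows and columns.
\<close>

lemma next_conormal_commute:
  assumes nz: "f00 \<noteq> 0" "f01 \<noteq> 0"
    and eqs: "f01 * f10 - f11 * f00 = k1 * l1" "f00 * (k2 - k1) - f01 * (k1 - k0) = k1 * (l1 - l0)"
    and d: "d = b + c - a" and n: "n = next_conormal f00 f01 l0 l1 a c d"
  shows "next_conormal f01 f11 k1 k2 c d (d + n - c) = next_conormal f00 f10 k0 k1 a b d + d - b"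
proof -
  have "f00 * f01 * (next_conormal f01 f11 k1 k2 c d (d + n - c) $ i) =
      f00 * f01 * ((next_conormal f00 f10 k0 k1 a b d + d - b) $ i)" for i
  proof -
    define A B C where "A = a $ i" and "B = b $ i" and "C = c $ i"
    define N where "N = n $ i"
    have d': "d $ i = B + C - A" by (simp add: d A_def B_def C_def)
    have N: "f00 * N = (f00 + l1 + f01) * C - f01 * A - l0 * (B + C - A)"
      using nz unfolding N_def n next_conormal_def
      by (simp add: d' A_def[symmetric] C_def[symmetric] field_simps)
    have L: "f00 * f01 * (next_conormal f01 f11 k1 k2 c d (d + n - c) $ i) =
      f00 * (f01 + k2 + f11) * (B + C - A) - f00 * f11 * C - k1 * (f00 * (B + C - A) + f00 * N - f00 * C)"
      using nz unfolding next_conormal_def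
      by (simp add: d' A_def[symmetric] C_def[symmetric] N_def[symmetric] field_simps)
    have R: "f00 * f01 * ((next_conormal f00 f10 k0 k1 a b d + d - b) $ i) =
      f01 * ((f00 + k1 + f10) * B - f10 * A - k0 * (B + C - A)) + f00 * f01 * (C - A)"
      using nz unfolding next_conormal_def
      by (simp add: d' A_def[symmetric] B_def[symmetric] field_simps)
    show ?thesis
      \<comment> \<open>Write the difference of both sides in A, C and B + C - A. The coefficient of
        A cancels, that of C vanishes by the first equation in \<open>eqs\<close>, and that of B + C
        - A by both equations together.\<close>
      unfolding L R N using eqs by algebra
  qed
  then show ?thesis
    using nz by (simp add: vec_eq_iff)
qed

text \<open>
  A state (a, b, c, x) at a square consists of the co-normals at its lower left, lower right and
  upper left vertex and the position of the lower left vertex.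
\<close>

type_synonym state = "(real^3) \<times> (real^3) \<times> (real^3) \<times> (real^3)"

text \<open>To the left and downwards, the new vertex e continues the edge ba or ca backwards
  through a, and the parallelogram relation gives the remaining co-normal. The final branch is meant
  for a downward step; only neighbouring squares matter.\<close>

definition state_transition ::
    "(int \<Rightarrow> int \<Rightarrow> real) \<Rightarrow> (int \<Rightarrow> int \<Rightarrow> real) \<Rightarrow> (int \<Rightarrow> int \<Rightarrow> real) \<Rightarrow>
      int \<times> int \<Rightarrow> int \<times> int \<Rightarrow> state \<Rightarrow> state" where
  "state_transition F A B s t = (\<lambda>(a, b, c, x).
    let (u, v) = s; (u', v') = t; d = b + c - a; f = F u v; f' = F u' v' in
    if u' = u + 1 then
      (b, next_conormal f f' (A (u + 1) v) (A (u + 1) (v + 1)) a b d, d, x + cross3 a b)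
    else if u = u' + 1 then
      let e = next_conormal f f' (A u v) (A u (v + 1)) b a c in (e, a, c - a + e, x - cross3 e a)
    else if v' = v + 1 then
      (c, d, next_conormal f f' (B u (v + 1)) (B (u + 1) (v + 1)) a c d, x - cross3 a c)
    else
      let e = next_conormal f f' (B u v) (B (u + 1) v) c a b in (e, b - a + e, a, x + cross3 e a))"

lemma state_transition_right:
  "state_transition F A B (u, v) (u + 1, v) (a, b, c, x) =
    (b, next_conormal (F u v) (F (u + 1) v) (A (u + 1) v) (A (u + 1) (v + 1)) a b (b + c - a),
      b + c - a, x + cross3 a b)"
  by (simp add: state_transition_def Let_def)

lemma state_transition_up:
  "state_transition F A B (u, v) (u, v + 1) (a, b, c, x) =
    (c, b + c - a, next_conormal (F u v) (F u (v + 1)) (B u (v + 1)) (B (u + 1) (v + 1)) a c (b + c - a),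
      x - cross3 a c)"
  by (simp add: state_transition_def Let_def)

lemma state_transition_inverse:
  assumes nz: "F (fst s) (snd s) \<noteq> 0" "F (fst t) (snd t) \<noteq> 0" and "share_edge s t"
  shows "state_transition F A B t s (state_transition F A B s t X) = X"
proof -
  obtain a b c x where X: "X = (a, b, c, x)" using prod_cases4 by blast
  have c: "b + c - (b + c - a) = a" "b + c - a - b = c - a" "b + c - a - c = b - a" "c - a + x + a - x = c"
    "b + (c - a + y) - y = b + c - a" "b - a + y + c - y = b + c - a" "a + (c - a + y) - y = c"
    "b - a + y + a - y = b" for x y a b c :: "real^3"
    by simp_all
  show ?thesis
    using assms(3)
  proof (cases rule: share_edge_cases)
    case right
    then show ?thesis using nz
      by (simp add: X state_transition_def Let_def next_conormal_back c)
  next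
    case left
    then show ?thesis using nz
      by (simp add: X state_transition_def Let_def next_conormal_back c)
  next
    case up
    then show ?thesis using nz
      by (simp add: X state_transition_def Let_def next_conormal_back c)
  next
    case down
    then show ?thesis using nz
      by (simp add: X state_transition_def Let_def next_conormal_back c)
  qed
qed


text \<open>The assumptions \<open>eqs\<close> are the compatibility equations at the vertex
  \<open>(u + 1, v + 1)\<close>. The co-normals agree by \<open>next_conormal_commute\<close>,
  applied once to rows and once with rows and columns exchanged.\<close>

lemma state_transition_commute:
  assumes nz: "F u v \<noteq> 0" "F (u + 1) v \<noteq> 0" "F u (v + 1) \<noteq> 0"
    and eqs: "F u (v + 1) * F (u + 1) v - F (u + 1) (v + 1) * F u v = A (u + 1) (v + 1) * B (u + 1) (v + 1)"
      "F u v * (B (u + 2) (v + 1) - B (u + 1) (v + 1)) - F (u + 1) v * (B (u + 1) (v + 1) - B u (v + 1)) =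
        B (u + 1) (v + 1) * (A (u + 1) (v + 1) - A (u + 1) v)"
      "F u v * (A (u + 1) (v + 2) - A (u + 1) (v + 1)) - F u (v + 1) * (A (u + 1) (v + 1) - A (u + 1) v) =
        A (u + 1) (v + 1) * (B (u + 1) (v + 1) - B u (v + 1))"
  shows "state_transition F A B (u + 1, v) (u + 1, v + 1) (state_transition F A B (u, v) (u + 1, v) X) =
    state_transition F A B (u, v + 1) (u + 1, v + 1) (state_transition F A B (u, v) (u, v + 1) X)"
proof -
  obtain a b c x where X: "X = (a, b, c, x)" using prod_cases4 by blast
  define d where "d = b + c - a"
  define e where "e = next_conormal (F u v) (F (u + 1) v) (A (u + 1) v) (A (u + 1) (v + 1)) a b d"
  define n where "n = next_conormal (F u v) (F u (v + 1)) (B u (v + 1)) (B (u + 1) (v + 1)) a c d"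
  have 1: "next_conormal (F u (v + 1)) (F (u + 1) (v + 1)) (A (u + 1) (v + 1)) (A (u + 1) (v + 2)) c d (d + n - c)
      = e + d - b"
    unfolding e_def by (rule next_conormal_commute[OF nz(1,3) eqs(1,3) d_def n_def])
  have 2: "next_conormal (F (u + 1) v) (F (u + 1) (v + 1)) (B (u + 1) (v + 1)) (B (u + 2) (v + 1)) b d (d + e - b)
      = n + d - c"
    unfolding n_def by (rule next_conormal_commute[OF nz(1,2) _ eqs(2) _ e_def])
      (use eqs(1) in \<open>simp_all add: d_def mult.commute\<close>)
  \<comment> \<open>Both sides are the position of the vertex carrying d, reached along the two
    sides of the lower left square.\<close>
  have "x + cross3 a b - cross3 b d = x - cross3 a c + cross3 c d"
    unfolding d_def by (simp add: vec_eq_iff forall_3 cross3_def vector_3 algebra_simps)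
  then show ?thesis
    using 1 2
    by (simp add: X state_transition_right state_transition_up add.assoc d_def[symmetric]
        e_def[symmetric] n_def[symmetric]) (simp add: add.commute)
qed

text \<open>Co-normal and position at a corner, read off from the state of the square. The last
  branch is the upper right corner, whose position simplifies from x - a \<times> c + c \<times> (b
  + c - a).\<close>

definition corner_data :: "int \<times> int \<Rightarrow> state \<Rightarrow> int \<times> int \<Rightarrow> (real^3) \<times> (real^3)" where
  "corner_data s = (\<lambda>(a, b, c, x) p.
    if p = s then (a, x)
    else if p = (fst s + 1, snd s) then (b, x + cross3 a b)
    else if p = (fst s, snd s + 1) then (c, x - cross3 a c)
    else (b + c - a, x + cross3 c b))"

lemma corner_data_simps [simp]:
  "corner_data (u, v) (a, b, c, x) (u, v) = (a, x)"
  "corner_data (u, v) (a, b, c, x) (u + 1, v) = (b, x + cross3 a b)"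
  "corner_data (u, v) (a, b, c, x) (u, v + 1) = (c, x - cross3 a c)"
  "corner_data (u, v) (a, b, c, x) (u + 1, v + 1) = (b + c - a, x + cross3 c b)"
  by (simp_all add: corner_data_def)

text \<open>Steps to the right and upwards are computed directly; those to the left and downwards
  follow because the transitions are mutually inverse.\<close>

lemma corner_data_transition:
  assumes nz: "F (fst s) (snd s) \<noteq> 0" "F (fst t) (snd t) \<noteq> 0" and e: "share_edge s t"
    and p: "p \<in> corners s" "p \<in> corners t"
  shows "corner_data t (state_transition F A B s t X) p = corner_data s X p"
proof -
  have right: "corner_data (u + 1, v) (state_transition F A B (u, v) (u + 1, v) X) p = corner_data (u, v) X p"
    if "p \<in> corners (u, v)" "p \<in> corners (u + 1, v)" for u v X
  proof -
    obtain a b c x where X: "X = (a, b, c, x)" using prod_cases4 by blast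
    have "x + cross3 a b - cross3 b (b + c - a) = x + cross3 c b"
      by (simp add: vec_eq_iff forall_3 cross3_def vector_3 algebra_simps)
    moreover have "p = (u + 1, v) \<or> p = (u + 1, v + 1)"
      using that by (cases p) auto
    ultimately show ?thesis
      by (auto simp: X state_transition_right)
  qed
  have up: "corner_data (u, v + 1) (state_transition F A B (u, v) (u, v + 1) X) p = corner_data (u, v) X p"
    if "p \<in> corners (u, v)" "p \<in> corners (u, v + 1)" for u v X
  proof -
    obtain a b c x where X: "X = (a, b, c, x)" using prod_cases4 by blast
    have "x - cross3 a c + cross3 c (b + c - a) = x + cross3 c b"
      by (simp add: vec_eq_iff forall_3 cross3_def vector_3 algebra_simps)
    moreover have "p = (u, v + 1) \<or> p = (u + 1, v + 1)"
      using that by (cases p) auto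
    ultimately show ?thesis
      by (auto simp: X state_transition_up)
  qed
  note inv = state_transition_inverse[OF nz e, of A B X]
  from e show ?thesis
  proof (cases rule: share_edge_cases)
    case (left u v)
    then show ?thesis
      using right[of u v "state_transition F A B s t X"] inv p by simp
  next
    case (down u v)
    then show ?thesis
      using up[of u v "state_transition F A B s t X"] inv p by simp
  qed (use right up p in auto)
qed

subsection \<open>The co-normal map determined by the forms\<close>

definition surface_state :: "(int \<Rightarrow> int \<Rightarrow> real^3) \<Rightarrow> (int \<Rightarrow> int \<Rightarrow> real^3) \<Rightarrow> int \<times> int \<Rightarrow> state" where
  "surface_state \<nu> q = (\<lambda>(u, v). (\<nu> u v, \<nu> (u + 1) v, \<nu> u (v + 1), q u v))"

lemma square_vertices:
  "(u, v) \<in> squares D \<longleftrightarrow> (u, v) \<in> D \<and> (u + 1, v) \<in> D \<and> (u, v + 1) \<in> D \<and> (u + 1, v + 1) \<in> D"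
  by (auto simp: squares_def corners_def)

lemma conormal_metric_det3: "conormal_metric \<nu> u v = det3 (\<nu> u v) (\<nu> u (v + 1)) (\<nu> (u + 1) v)"
  by (simp add: conormal_metric_def det3_def det_3 cross3_def inner_vec_def sum_3 vector_3 algebra_simps)

lemma conormal_map_of_diff1:
  assumes "conormal_map_of D q \<nu>" "(u, v) \<in> D" "(u + 1, v) \<in> D"
  shows "q (u + 1) v = q u v + cross3 (\<nu> u v) (\<nu> (u + 1) v)"
proof -
  have "diff1 q u v = cross3 (\<nu> u v) (\<nu> (u + 1) v)"
    using assms by (simp add: conormal_map_of_def)
  then show ?thesis
    by (simp add: diff1_def algebra_simps)
qed

lemma conormal_map_of_diff2:
  assumes "conormal_map_of D q \<nu>" "(u, v) \<in> D" "(u, v + 1) \<in> D"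
  shows "q u (v + 1) = q u v - cross3 (\<nu> u v) (\<nu> u (v + 1))"
proof -
  have "diff2 q u v = - cross3 (\<nu> u v) (\<nu> u (v + 1))"
    using assms by (simp add: conormal_map_of_def)
  then show ?thesis
    by (simp add: diff2_def algebra_simps)
qed

lemma conormal_parallelogram:
  assumes "conormal_map D \<nu>" "(u, v) \<in> squares D"
  shows "\<nu> (u + 1) (v + 1) = \<nu> (u + 1) v + \<nu> u (v + 1) - \<nu> u v"
proof -
  have "diff12 \<nu> u v = 0"
    using assms by (simp add: conormal_map_def)
  then show ?thesis
    by (simp add: diff12_def algebra_simps)
qed

text \<open>By the parallelogram relation the four co-normals lie in one plane. The second
  difference of \<open>q\<close> is normal to it, so it has the same product with all four, namely
  the metric.\<close>

lemma inner_affine_normal: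
  assumes cm: "conormal_map_of D q \<nu>" and F: "conormal_metric \<nu> u v = F u v"
    and s: "(u, v) \<in> squares D" and p: "(m, n) \<in> corners (u, v)"
  shows "\<nu> m n \<bullet> affine_normal q F u v = 1"
proof -
  have cm': "conormal_map D \<nu>"
    using cm by (simp add: conormal_map_of_def)
  note d = conormal_parallelogram[OF cm' s]
  have "diff12 q u v = diff1 q u (v + 1) - diff1 q u v"
    by (simp add: diff12_def diff1_def)
  also have "\<dots> = cross3 (\<nu> u (v + 1)) (\<nu> (u + 1) (v + 1)) - cross3 (\<nu> u v) (\<nu> (u + 1) v)"
    using cm s by (simp add: conormal_map_of_def square_vertices)
  finally have q12: "diff12 q u v = \<dots>" .
  have "\<nu> m n \<bullet> diff12 q u v = conormal_metric \<nu> u v"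
    using p unfolding corners_iff q12 conormal_metric_def
    by (elim conjE disjE; simp only: d; simp add: cross3_def inner_vec_def sum_3 vector_3 algebra_simps)
  moreover have "conormal_metric \<nu> u v > 0"
    using cm' s by (simp add: conormal_map_def)
  ultimately show ?thesis
    using F by (simp add: affine_normal_def)
qed

text \<open>The identity (w \<times> z) \<times> (z \<times> e) = [w, z, e] z reduces the
  coefficient to a determinant of co-normals times the product of z with the affine normal. This
  product is 1 for every square at the vertex, so the choice of square is irrelevant.\<close>

lemma cubic_coefficient_det3:
  assumes cm: "conormal_map_of D q \<nu>" and F: "\<And>u v. (u, v) \<in> squares D \<Longrightarrow> conormal_metric \<nu> u v = F u v"
    and s: "s \<in> squares D" "(u, v) \<in> corners s"
  shows "(u - 1, v) \<in> D \<Longrightarrow> (u + 1, v) \<in> D \<Longrightarrow>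
      det3 (diff1 q (u - 1) v) (diff1 q u v) (affine_normal q F (fst s) (snd s)) =
      det3 (\<nu> (u - 1) v) (\<nu> u v) (\<nu> (u + 1) v)" (is "?a1 \<Longrightarrow> ?a2 \<Longrightarrow> ?A")
    and "(u, v - 1) \<in> D \<Longrightarrow> (u, v + 1) \<in> D \<Longrightarrow>
      det3 (diff2 q u v) (diff2 q u (v - 1)) (affine_normal q F (fst s) (snd s)) =
      det3 (\<nu> u (v + 1)) (\<nu> u v) (\<nu> u (v - 1))" (is "?b1 \<Longrightarrow> ?b2 \<Longrightarrow> ?B")
proof -
  have uv: "(u, v) \<in> D"
    using s by (auto simp: squares_def)
  have one: "\<nu> u v \<bullet> affine_normal q F (fst s) (snd s) = 1"
    using inner_affine_normal[of D q \<nu> "fst s" "snd s" F u v] cm F[of "fst s" "snd s"] s by simp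
  have 1: "det3 (cross3 w z) (cross3 z e) y = det3 w z e * (z \<bullet> y)" for w z e y
    by (simp add: det3_cross cross3_def inner_vec_def sum_3 vector_3 algebra_simps)
  have 2: "det3 (- cross3 z n) (- cross3 w z) y = det3 n z w * (z \<bullet> y)" for w z n y
    by (simp add: det3_cross cross3_def inner_vec_def sum_3 vector_3 algebra_simps)
  show ?A if ?a1 ?a2
  proof -
    have "diff1 q (u - 1) v = cross3 (\<nu> (u - 1) v) (\<nu> u v)" "diff1 q u v = cross3 (\<nu> u v) (\<nu> (u + 1) v)"
      using cm that uv unfolding conormal_map_of_def by (metis diff_add_cancel)+
    then show ?thesis by (simp add: 1 one)
  qed
  show ?B if ?b1 ?b2
  proof -
    have "diff2 q u (v - 1) = - cross3 (\<nu> u (v - 1)) (\<nu> u v)" "diff2 q u v = - cross3 (\<nu> u v) (\<nu> u (v + 1))"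
      using cm that uv unfolding conormal_map_of_def by (metis diff_add_cancel)+
    then show ?thesis by (simp add: 2 one)
  qed
qed

text \<open>The four numbers enter only through quotients by f. This reduces columns, where the
  orientation is reversed, to rows.\<close>

lemma next_conormal_uminus:
  "next_conormal (- f) (- f') (- k) (- l) a b d = next_conormal f f' k l a b d"
proof -
  have "(- l + - f') / - f = (l + f') / f"
    by (cases "f = 0") (simp_all add: field_simps)
  then show ?thesis
    by (simp add: next_conormal_def)
qed

lemma det3_next_conormal':
  fixes a b d :: "real^3" and f f' k l :: real
  defines "e \<equiv> next_conormal f f' k l a b d"
  assumes "f \<noteq> 0" "det3 a b d = f"
  shows "det3 b e d = f'" "det3 e b a = k" "det3 (e - b) d (a - b) = l"
proof -
  have e: "e = next_conormal (- f) (- f') (- k) (- l) a b d"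
    by (simp add: e_def next_conormal_uminus)
  have s: "det3 x y z = - det3 x z y" "det3 x y z = - det3 z y x" for x y z
    by (simp_all add: det3_def det_3 vector_3 algebra_simps)
  show "det3 b e d = f'" "det3 e b a = k" "det3 (e - b) d (a - b) = l"
    using det3_next_conormal[of "- f" a d b "- f'" "- k" "- l"] assms(2,3)
      s(1)[of a d b] s(1)[of b d e] s(2)[of a b e] s(2)[of "a - b" d "e - b"] unfolding e[symmetric]
    by simp_all
qed

lemma next_conormal_unique':
  assumes "f \<noteq> 0" "det3 a b d = f" "det3 b e d = f'" "det3 e b a = k" "det3 (e - b) d (a - b) = l"
  shows "e = next_conormal f f' k l a b d"
proof -
  have s: "det3 x y z = - det3 x z y" "det3 x y z = - det3 z y x" for x y z
    by (simp_all add: det3_def det_3 vector_3 algebra_simps)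
  show ?thesis
    using next_conormal_unique[of "- f" a d b e "- f'" "- k" "- l"] assms next_conormal_uminus
      s(1)[of a d b] s(1)[of b d e] s(2)[of a b e] s(2)[of "a - b" d "e - b"]
    by simp
qed

text \<open>For steps to the right and upwards, the two metrics and the cubic coefficients at both
  ends of the common edge are the data of Cramer's rule. The other two directions follow by
  inversion.\<close>

lemma surface_state_transition:
  assumes cm: "conormal_map_of D q \<nu>" and F: "\<And>u v. (u, v) \<in> squares D \<Longrightarrow> conormal_metric \<nu> u v = F u v"
    and cubic: "has_cubic_form D q F A B"
    and st: "s \<in> squares D" "t \<in> squares D" "share_edge s t"
  shows "surface_state \<nu> q t = state_transition F A B s t (surface_state \<nu> q s)"
proof -
  have cm': "conormal_map D \<nu>"
    using cm by (simp add: conormal_map_of_def)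
  have pos: "F u v > 0" if "(u, v) \<in> squares D" for u v
    using cm' F that by (auto simp: conormal_map_def)
  have A: "A (u + 1) w = det3 (\<nu> u w) (\<nu> (u + 1) w) (\<nu> (u + 2) w)"
    if "(u, v) \<in> squares D" "(u + 1, v) \<in> squares D" "w = v \<or> w = v + 1" for u v w
  proof -
    have "(u + 1, w) \<in> corners (u, v)" "(u + 1 - 1, w) \<in> D" "(u + 1 + 1, w) \<in> D"
      using that by (auto simp: square_vertices)
    then show ?thesis
      using cubic[unfolded has_cubic_form_def, rule_format, OF that(1), of "u + 1" w]
        cubic_coefficient_det3(1)[where \<nu> = \<nu> and F = F and s = "(u, v)" and u = "u + 1" and v = w,
          OF cm F that(1)]
      by (simp add: add.commute)
  qed
  have B: "B w (v + 1) = det3 (\<nu> w (v + 2)) (\<nu> w (v + 1)) (\<nu> w v)"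
    if "(u, v) \<in> squares D" "(u, v + 1) \<in> squares D" "w = u \<or> w = u + 1" for u v w
  proof -
    have "(w, v + 1) \<in> corners (u, v)" "(w, v + 1 - 1) \<in> D" "(w, v + 1 + 1) \<in> D"
      using that by (auto simp: square_vertices)
    then show ?thesis
      using cubic[unfolded has_cubic_form_def, rule_format, OF that(1), of w "v + 1"]
        cubic_coefficient_det3(2)[where \<nu> = \<nu> and F = F and s = "(u, v)" and u = w and v = "v + 1",
          OF cm F that(1)]
      by (simp add: add.commute)
  qed
  have q: "q (u + 1) v = q u v + cross3 (\<nu> u v) (\<nu> (u + 1) v)"
    "q u (v + 1) = q u v - cross3 (\<nu> u v) (\<nu> u (v + 1))" if "(u, v) \<in> squares D" for u v
    using conormal_map_of_diff1[OF cm] conormal_map_of_diff2[OF cm] that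
    unfolding square_vertices by blast+
  have right: "surface_state \<nu> q (u + 1, v) = state_transition F A B (u, v) (u + 1, v) (surface_state \<nu> q (u, v))"
    if h: "(u, v) \<in> squares D" "(u + 1, v) \<in> squares D" for u v
  proof -
    note d = conormal_parallelogram[OF cm' h(1)] and d' = conormal_parallelogram[OF cm' h(2)]
    let ?a = "\<nu> u v" and ?b = "\<nu> (u + 1) v" and ?c = "\<nu> u (v + 1)" and ?d = "\<nu> (u + 1) (v + 1)"
      and ?e = "\<nu> (u + 2) v"
    have "?e = next_conormal (F u v) (F (u + 1) v) (A (u + 1) v) (A (u + 1) (v + 1)) ?a ?b ?d"
    proof (rule next_conormal_unique)
      show "F u v \<noteq> 0" using pos[OF h(1)] by simp
      show "det3 ?a ?d ?b = F u v" "det3 ?b ?d ?e = F (u + 1) v"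
        using F[OF h(1)] F[OF h(2)] unfolding d
        by (simp_all add: conormal_metric_det3 d add.assoc) (simp add: det3_def det_3 vector_3 algebra_simps)
      show "det3 ?a ?b ?e = A (u + 1) v"
        using A[OF h] by simp
      have c: "?c = ?a - ?b + ?d" and n: "\<nu> (u + 2) (v + 1) = ?e - ?b + ?d"
        using d d' by (simp_all add: add.assoc)
      have "det3 ?c ?d (\<nu> (u + 2) (v + 1)) = A (u + 1) (v + 1)"
        using A[OF h] by simp
      then show "det3 (?a - ?b) ?d (?e - ?b) = A (u + 1) (v + 1)"
        unfolding n c by (simp only: det3_shear)
    qed
    then show ?thesis
      by (simp add: surface_state_def state_transition_right d[symmetric] q(1)[OF h(1)] add.assoc)
  qed
  have up: "surface_state \<nu> q (u, v + 1) = state_transition F A B (u, v) (u, v + 1) (surface_state \<nu> q (u, v))"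
    if h: "(u, v) \<in> squares D" "(u, v + 1) \<in> squares D" for u v
  proof -
    note d = conormal_parallelogram[OF cm' h(1)] and d' = conormal_parallelogram[OF cm' h(2)]
    let ?a = "\<nu> u v" and ?b = "\<nu> (u + 1) v" and ?c = "\<nu> u (v + 1)" and ?d = "\<nu> (u + 1) (v + 1)"
      and ?e = "\<nu> u (v + 2)"
    have "?e = next_conormal (F u v) (F u (v + 1)) (B u (v + 1)) (B (u + 1) (v + 1)) ?a ?c ?d"
    proof (rule next_conormal_unique')
      show "F u v \<noteq> 0" using pos[OF h(1)] by simp
      show "det3 ?a ?c ?d = F u v" "det3 ?c ?e ?d = F u (v + 1)"
        using F[OF h(1)] F[OF h(2)] unfolding d
        by (simp_all add: conormal_metric_det3 d add.assoc) (simp add: det3_def det_3 vector_3 algebra_simps)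
      show "det3 ?e ?c ?a = B u (v + 1)"
        using B[OF h] by simp
      have b: "?b = ?a - ?c + ?d" and n: "\<nu> (u + 1) (v + 2) = ?e - ?c + ?d"
        using d d' by (simp_all add: add.assoc)
      have "det3 (\<nu> (u + 1) (v + 2)) ?d ?b = B (u + 1) (v + 1)"
        using B[OF h] by simp
      then show "det3 (?e - ?c) ?d (?a - ?c) = B (u + 1) (v + 1)"
        unfolding n b by (simp only: det3_shear)
    qed
    then show ?thesis
      by (simp add: surface_state_def state_transition_up d[symmetric] q(2)[OF h(1)] add.assoc)
  qed
  have inv: "state_transition F A B s t (state_transition F A B t s X) = X" for X
    using st pos by (intro state_transition_inverse) (auto simp: share_edge_commute, (metis less_irrefl prod.collapse)+)
  from st(3) show ?thesis
  proof (cases rule: share_edge_cases)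
    case (left u v)
    then show ?thesis using right[of u v] inv st by simp
  next
    case (down u v)
    then show ?thesis using up[of u v] inv st by simp
  qed (use right up st in auto)
qed


section \<open>Squares along lattice lines and recovery of the cubic form\<close>

lemma simply_connected_domain_edge:
  assumes "simply_connected_domain D" "p \<in> D" "p' \<in> D" "share_edge p p'"
  shows "\<exists>s\<in>squares D. {p, p'} \<subseteq> corners s"
  using assms unfolding simply_connected_domain_def by blast

lemma simply_connected_domain_not_pinched:
  assumes "simply_connected_domain D" "s \<in> squares D" "r \<in> squares D"
    and "\<bar>fst s - fst r\<bar> = 1" "\<bar>snd s - snd r\<bar> = 1"
  shows "\<exists>t\<in>squares D. share_edge s t \<and> share_edge t r"
  using assms unfolding simply_connected_domain_def by blast

text \<open>Each of the two edges bounds a square. If these squares lie on opposite sides of the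
  row, they are opposite at the middle vertex, and since the domain is not pinched there, a third
  square completes a pair on one side.\<close>

lemma row_squares:
  assumes D: "simply_connected_domain D" and p: "(u - 1, v) \<in> D" "(u, v) \<in> D" "(u + 1, v) \<in> D"
  obtains w where "(u - 1, w) \<in> squares D" "(u, w) \<in> squares D" "v = w \<or> v = w + 1"
proof -
  note edge = simply_connected_domain_edge[OF D]
  note pinch = simply_connected_domain_not_pinched[OF D]
  obtain w where w: "(u - 1, w) \<in> squares D" "v = w \<or> v = w + 1"
    using edge[OF p(1,2)] by (fastforce simp: share_edge_def corners_def)
  obtain w' where w': "(u, w') \<in> squares D" "v = w' \<or> v = w' + 1"
    using edge[OF p(2,3)] by (fastforce simp: share_edge_def corners_def)
  show ?thesis
  proof (cases "w = w'")
    case False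
    then have "\<bar>w - w'\<bar> = 1"
      using w(2) w'(2) by auto
    then obtain t where t: "t \<in> squares D" "share_edge (u - 1, w) t" "share_edge t (u, w')"
      using pinch[OF w(1) w'(1)] by auto
    then have "t = (u - 1, w') \<or> t = (u, w)"
      using common_neighbour[OF t(2,3)] \<open>\<bar>w - w'\<bar> = 1\<close> by simp
    with t(1) show ?thesis
      using that w w' by blast
  qed (use that w w' in auto)
qed

lemma column_squares:
  assumes D: "simply_connected_domain D" and p: "(u, v - 1) \<in> D" "(u, v) \<in> D" "(u, v + 1) \<in> D"
  obtains w where "(w, v - 1) \<in> squares D" "(w, v) \<in> squares D" "u = w \<or> u = w + 1"
proof -
  note edge = simply_connected_domain_edge[OF D]
  note pinch = simply_connected_domain_not_pinched[OF D]
  obtain w where w: "(w, v - 1) \<in> squares D" "u = w \<or> u = w + 1"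
    using edge[OF p(1,2)] by (fastforce simp: share_edge_def corners_def)
  obtain w' where w': "(w', v) \<in> squares D" "u = w' \<or> u = w' + 1"
    using edge[OF p(2,3)] by (fastforce simp: share_edge_def corners_def)
  show ?thesis
  proof (cases "w = w'")
    case False
    then have "\<bar>w - w'\<bar> = 1"
      using w(2) w'(2) by auto
    then obtain t where t: "t \<in> squares D" "share_edge (w, v - 1) t" "share_edge t (w', v)"
      using pinch[OF w(1) w'(1)] by auto
    then have "t = (w, v) \<or> t = (w', v - 1)"
      using common_neighbour[OF t(2,3)] \<open>\<bar>w - w'\<bar> = 1\<close> by simp
    with t(1) show ?thesis
      using that w w' by blast
  qed (use that w w' in auto)
qed

text \<open>The converse of \<open>surface_state_transition\<close>. A transition reveals the
  determinants at both ends of the common edge, and \<open>row_squares\<close> and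
  \<open>column_squares\<close> show that every prescribed coefficient sits at such an end.\<close>

lemma has_cubic_form_of_transition:
  assumes D: "simply_connected_domain D" and cm: "conormal_map_of D q \<nu>"
    and F: "\<And>u v. (u, v) \<in> squares D \<Longrightarrow> conormal_metric \<nu> u v = F u v"
    and tr: "\<And>s t. s \<in> squares D \<Longrightarrow> t \<in> squares D \<Longrightarrow> share_edge s t \<Longrightarrow>
      surface_state \<nu> q t = state_transition F A B s t (surface_state \<nu> q s)"
  shows "has_cubic_form D q F A B"
proof -
  have cm': "conormal_map D \<nu>"
    using cm by (simp add: conormal_map_of_def)
  have nz: "F u v \<noteq> 0" if "(u, v) \<in> squares D" for u v
    using cm' F that by (fastforce simp: conormal_map_def)
  have row: "A (u + 1) v = det3 (\<nu> u v) (\<nu> (u + 1) v) (\<nu> (u + 2) v)"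
    "A (u + 1) (v + 1) = det3 (\<nu> u (v + 1)) (\<nu> (u + 1) (v + 1)) (\<nu> (u + 2) (v + 1))"
    if h: "(u, v) \<in> squares D" "(u + 1, v) \<in> squares D" for u v
  proof -
    note d = conormal_parallelogram[OF cm' h(1)] and d' = conormal_parallelogram[OF cm' h(2)]
    let ?a = "\<nu> u v" and ?b = "\<nu> (u + 1) v" and ?c = "\<nu> u (v + 1)" and ?d = "\<nu> (u + 1) (v + 1)"
      and ?e = "\<nu> (u + 2) v"
    have e: "?e = next_conormal (F u v) (F (u + 1) v) (A (u + 1) v) (A (u + 1) (v + 1)) ?a ?b ?d"
      using tr[OF h] by (simp add: share_edge_def surface_state_def state_transition_right d add.assoc)
    have f: "det3 ?a ?d ?b = F u v"
      using F[OF h(1)] unfolding d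
      by (simp add: conormal_metric_det3) (simp add: det3_def det_3 vector_3 algebra_simps)
    note det = det3_next_conormal[OF nz[OF h(1)] f, of "F (u + 1) v" "A (u + 1) v" "A (u + 1) (v + 1)",
        folded e]
    show "A (u + 1) v = det3 ?a ?b ?e"
      using det(2) by simp
    have c: "?c = ?a - ?b + ?d" and n: "\<nu> (u + 2) (v + 1) = ?e - ?b + ?d"
      using d d' by (simp_all add: add.assoc)
    show "A (u + 1) (v + 1) = det3 ?c ?d (\<nu> (u + 2) (v + 1))"
      using det(3) unfolding n c by (simp only: det3_shear)
  qed
  have col: "B u (v + 1) = det3 (\<nu> u (v + 2)) (\<nu> u (v + 1)) (\<nu> u v)"
    "B (u + 1) (v + 1) = det3 (\<nu> (u + 1) (v + 2)) (\<nu> (u + 1) (v + 1)) (\<nu> (u + 1) v)"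
    if h: "(u, v) \<in> squares D" "(u, v + 1) \<in> squares D" for u v
  proof -
    note d = conormal_parallelogram[OF cm' h(1)] and d' = conormal_parallelogram[OF cm' h(2)]
    let ?a = "\<nu> u v" and ?b = "\<nu> (u + 1) v" and ?c = "\<nu> u (v + 1)" and ?d = "\<nu> (u + 1) (v + 1)"
      and ?e = "\<nu> u (v + 2)"
    have e: "?e = next_conormal (F u v) (F u (v + 1)) (B u (v + 1)) (B (u + 1) (v + 1)) ?a ?c ?d"
      using tr[OF h] by (simp add: share_edge_def surface_state_def state_transition_up d add.assoc)
    have f: "det3 ?a ?c ?d = F u v"
      using F[OF h(1)] unfolding d
      by (simp add: conormal_metric_det3) (simp add: det3_def det_3 vector_3 algebra_simps)
    note det = det3_next_conormal'[OF nz[OF h(1)] f, of "F u (v + 1)" "B u (v + 1)" "B (u + 1) (v + 1)",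
        folded e]
    show "B u (v + 1) = det3 ?e ?c ?a"
      using det(2) by simp
    have b: "?b = ?a - ?c + ?d" and n: "\<nu> (u + 1) (v + 2) = ?e - ?c + ?d"
      using d d' by (simp_all add: add.assoc)
    show "B (u + 1) (v + 1) = det3 (\<nu> (u + 1) (v + 2)) ?d ?b"
      using det(3) unfolding n b by (simp only: det3_shear)
  qed
  have A: "A u v = det3 (\<nu> (u - 1) v) (\<nu> u v) (\<nu> (u + 1) v)"
    if h: "(u - 1, v) \<in> D" "(u, v) \<in> D" "(u + 1, v) \<in> D" for u v
    using row_squares[OF D h]
  proof cases
    case (1 w)
    then show ?thesis
      using row[of "u - 1" w] by (auto simp: algebra_simps)
  qed
  have B: "B u v = det3 (\<nu> u (v + 1)) (\<nu> u v) (\<nu> u (v - 1))"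
    if h: "(u, v - 1) \<in> D" "(u, v) \<in> D" "(u, v + 1) \<in> D" for u v
    using column_squares[OF D h]
  proof cases
    case (1 w)
    then show ?thesis
      using col[of w "v - 1"] by (auto simp: algebra_simps)
  qed
  show ?thesis
    unfolding has_cubic_form_def
  proof (intro allI ballI impI conjI; elim conjE)
    fix u v s assume s: "s \<in> squares D" "(u, v) \<in> corners s"
    then have uv: "(u, v) \<in> D" by (auto simp: squares_def)
    note c = cubic_coefficient_det3[where \<nu> = \<nu> and F = F, OF cm F s]
    show "A u v = det3 (diff1 q (u - 1) v) (diff1 q u v) (affine_normal q F (fst s) (snd s))"
      if "(u - 1, v) \<in> D" "(u + 1, v) \<in> D"
      using A c(1) that uv by simp
    show "B u v = det3 (diff2 q u v) (diff2 q u (v - 1)) (affine_normal q F (fst s) (snd s))"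
      if "(u, v - 1) \<in> D" "(u, v + 1) \<in> D"
      using B c(2) that uv by simp
  qed
qed

subsection \<open>Existence\<close>

definition state_metric :: "state \<Rightarrow> real" where
  "state_metric = (\<lambda>(a, b, c, x). det3 a c b)"

text \<open>\<open>next_conormal\<close> is built to give the new square the metric f', provided
  that the old one has metric f. So only the initial state has to be chosen correctly.\<close>

lemma state_metric_transition:
  assumes nz: "F (fst s) (snd s) \<noteq> 0" and e: "share_edge s t" and X: "state_metric X = F (fst s) (snd s)"
  shows "state_metric (state_transition F A B s t X) = F (fst t) (snd t)"
proof -
  obtain a b c x where Xe: "X = (a, b, c, x)" using prod_cases4 by blast
  have m: "det3 e (c - a + e) a = det3 a e c" "det3 e a (b - a + e) = det3 a b e" for a b c e
    by (simp_all add: det3_def det_3 vector_3 algebra_simps)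
  have "det3 a c b = F (fst s) (snd s)"
    using X by (simp add: Xe state_metric_def)
  then have f: "det3 a (b + c - a) b = F (fst s) (snd s)" "det3 a c (b + c - a) = F (fst s) (snd s)"
    "det3 b a c = F (fst s) (snd s)" "det3 c b a = F (fst s) (snd s)"
    by (simp_all add: det3_def det_3 vector_3 algebra_simps)
  note n = det3_next_conormal(1) det3_next_conormal'(1)
  from e show ?thesis
    by (cases rule: share_edge_cases)
      (use nz f in \<open>simp_all add: Xe state_metric_def state_transition_def Let_def m n\<close>)
qed

text \<open>Two squares with a common vertex are equal, adjacent or opposite. In the last case a
  square adjacent to both also contains the vertex, as the domain is not pinched.\<close>

lemma corner_data_agree:
  assumes D: "simply_connected_domain D" and nz: "\<And>u v. (u, v) \<in> squares D \<Longrightarrow> F u v \<noteq> 0"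
    and tr: "\<And>s t. s \<in> squares D \<Longrightarrow> t \<in> squares D \<Longrightarrow> share_edge s t \<Longrightarrow>
      \<Phi> t = state_transition F A B s t (\<Phi> s)"
    and s: "s \<in> squares D" "r \<in> squares D" "p \<in> corners s" "p \<in> corners r"
  shows "corner_data s (\<Phi> s) p = corner_data r (\<Phi> r) p"
proof -
  have adj: "corner_data s (\<Phi> s) p = corner_data t (\<Phi> t) p"
    if "s \<in> squares D" "t \<in> squares D" "share_edge s t" "p \<in> corners s" "p \<in> corners t" for s t
    using corner_data_transition[of F s t p A B "\<Phi> s"] tr nz that by simp
  obtain a b c d where sr: "s = (a, b)" "r = (c, d)" by fastforce
  obtain m n where p: "p = (m, n)" by fastforce
  have "s = r \<or> share_edge s r \<or> \<bar>a - c\<bar> = 1 \<and> \<bar>b - d\<bar> = 1"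
    using s(3,4) unfolding sr p share_edge_def by auto
  then consider "s = r" | "share_edge s r" | "\<bar>a - c\<bar> = 1" "\<bar>b - d\<bar> = 1" by blast
  then show ?thesis
  proof cases
    case 3
    then obtain t where t: "t \<in> squares D" "share_edge s t" "share_edge t r"
      using simply_connected_domain_not_pinched[OF D s(1,2)] by (auto simp: sr)
    have "p \<in> corners t"
      using common_neighbour[OF t(2,3)] 3 s(3,4) by (auto simp: sr p)
    then show ?thesis
      using adj[of s t] adj[of t r] t s by simp
  qed (use adj s in auto)
qed

text \<open>The states are glued vertex by vertex. Every edge of the domain bounds a square, so all
  difference equations can be checked inside single squares.\<close>

lemma ex_surface_of_states:
  assumes D: "simply_connected_domain D" and pos: "\<And>u v. (u, v) \<in> squares D \<Longrightarrow> F u v > 0"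
    and tr: "\<And>s t. s \<in> squares D \<Longrightarrow> t \<in> squares D \<Longrightarrow> share_edge s t \<Longrightarrow>
      \<Phi> t = state_transition F A B s t (\<Phi> s)"
    and metric: "\<And>s. s \<in> squares D \<Longrightarrow> state_metric (\<Phi> s) = F (fst s) (snd s)"
  obtains q \<nu> where "conormal_map_of D q \<nu>"
    "\<And>u v. (u, v) \<in> squares D \<Longrightarrow> conormal_metric \<nu> u v = F u v"
    "\<And>s. s \<in> squares D \<Longrightarrow> surface_state \<nu> q s = \<Phi> s"
proof -
  \<comment> \<open>Any square at \<open>p\<close> gives the same data by
    \<open>corner_data_agree\<close>; at points of no square the value is arbitrary.\<close>
  define \<sigma> where "\<sigma> p = (SOME s. s \<in> squares D \<and> p \<in> corners s)" for p
  define h where "h p = corner_data (\<sigma> p) (\<Phi> (\<sigma> p)) p" for p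
  define \<nu> q where "\<nu> u v = fst (h (u, v))" and "q u v = snd (h (u, v))" for u v
  have h: "h p = corner_data s (\<Phi> s) p" if "s \<in> squares D" "p \<in> corners s" for s p
  proof -
    have "\<sigma> p \<in> squares D \<and> p \<in> corners (\<sigma> p)"
      unfolding \<sigma>_def by (rule someI[of _ s]) (use that in auto)
    then show ?thesis
      unfolding h_def using that by (intro corner_data_agree[OF D _ tr]) (use pos in fastforce)+
  qed
  have vals: "\<exists>a b c x. \<Phi> (u, v) = (a, b, c, x) \<and> det3 a c b = F u v \<and>
      \<nu> u v = a \<and> \<nu> (u + 1) v = b \<and> \<nu> u (v + 1) = c \<and> \<nu> (u + 1) (v + 1) = b + c - a \<and>
      q u v = x \<and> q (u + 1) v = x + cross3 a b \<and> q u (v + 1) = x - cross3 a c \<and>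
      q (u + 1) (v + 1) = x + cross3 c b" if "(u, v) \<in> squares D" for u v
  proof -
    obtain a b c x where "\<Phi> (u, v) = (a, b, c, x)" using prod_cases4 by blast
    then show ?thesis
      using that metric[OF that] by (simp add: \<nu>_def q_def h[OF that] state_metric_def)
  qed
  note edge = simply_connected_domain_edge[OF D]
  have d1: "diff1 q u v = cross3 (\<nu> u v) (\<nu> (u + 1) v)" if "(u, v) \<in> D" "(u + 1, v) \<in> D" for u v
  proof -
    have "(u, v) \<in> squares D \<or> (u, v - 1) \<in> squares D"
      using edge[OF that] by (fastforce simp: share_edge_def corners_def)
    then show ?thesis
    proof
      assume "(u, v) \<in> squares D"
      from vals[OF this] show ?thesis by (auto simp: diff1_def)
    next
      \<comment> \<open>Here the edge is the top edge of the square below and joins the corners with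
        co-normals c and b + c - a.\<close>
      assume "(u, v - 1) \<in> squares D"
      then have "\<exists>a b c x. \<nu> u v = c \<and> \<nu> (u + 1) v = b + c - a \<and> q u v = x - cross3 a c \<and>
          q (u + 1) v = x + cross3 c b"
        using vals[of u "v - 1"] by force
      moreover have "x + cross3 c b - (x - cross3 a c) = cross3 c (b + c - a)" for x a b c
        by (simp add: vec_eq_iff forall_3 cross3_def vector_3 algebra_simps)
      ultimately show ?thesis by (auto simp: diff1_def)
    qed
  qed
  have d2: "diff2 q u v = - cross3 (\<nu> u v) (\<nu> u (v + 1))" if "(u, v) \<in> D" "(u, v + 1) \<in> D" for u v
  proof -
    have "(u, v) \<in> squares D \<or> (u - 1, v) \<in> squares D"
      using edge[OF that] by (fastforce simp: share_edge_def corners_def)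
    then show ?thesis
    proof
      assume "(u, v) \<in> squares D"
      from vals[OF this] show ?thesis by (auto simp: diff2_def)
    next
      assume "(u - 1, v) \<in> squares D"
      then have "\<exists>a b c x. \<nu> u v = b \<and> \<nu> u (v + 1) = b + c - a \<and> q u v = x + cross3 a b \<and>
          q u (v + 1) = x + cross3 c b"
        using vals[of "u - 1" v] by force
      moreover have "x + cross3 c b - (x + cross3 a b) = - cross3 b (b + c - a)" for x a b c
        by (simp add: vec_eq_iff forall_3 cross3_def vector_3 algebra_simps)
      ultimately show ?thesis by (auto simp: diff2_def)
    qed
  qed
  have m: "conormal_metric \<nu> u v = F u v" if "(u, v) \<in> squares D" for u v
    using vals[OF that] by (auto simp: conormal_metric_det3)
  have "diff12 \<nu> u v = 0" if "(u, v) \<in> squares D" for u v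
    using vals[OF that] by (auto simp: diff12_def)
  then have "conormal_map_of D q \<nu>"
    unfolding conormal_map_of_def conormal_map_def using m pos d1 d2 by simp
  moreover have "surface_state \<nu> q s = \<Phi> s" if "s \<in> squares D" for s
    using vals[of "fst s" "snd s"] that by (auto simp: surface_state_def split: prod.split)
  ultimately show ?thesis
    using that m by blast
qed

subsection \<open>Uniqueness\<close>

definition affine_state :: "real^3^3 \<Rightarrow> real^3^3 \<Rightarrow> real^3 \<Rightarrow> state \<Rightarrow> state" where
  "affine_state L M z = (\<lambda>(a, b, c, x). (L *v a, L *v b, L *v c, M *v x + z))"

text \<open>Co-normals change by linear combinations whose coefficients do not depend on the state,
  positions by adding cross products. \<open>L\<close> commutes with the former, and
  \<open>LM\<close> handles the latter.\<close>

lemma state_transition_affine: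
  assumes LM: "\<And>x y. cross3 (L *v x) (L *v y) = M *v cross3 x y" and e: "share_edge s t"
  shows "state_transition F A B s t (affine_state L M z X) = affine_state L M z (state_transition F A B s t X)"
proof -
  obtain a b c x where X: "X = (a, b, c, x)" using prod_cases4 by blast
  have n: "next_conormal f f' k l (L *v a) (L *v b) (L *v d) = L *v next_conormal f f' k l a b d"
    for f f' k l a b d
    by (simp add: next_conormal_def matrix_vector_mult_diff_distrib matrix_vector_mult_scaleR)
  have add: "L *v x + L *v y = L *v (x + y)" "L *v x - L *v y = L *v (x - y)" for x y
    by (simp_all add: matrix_vector_mult_diff_distrib matrix_vector_right_distrib)
  have pos: "M *v x + z + M *v y = M *v (x + y) + z" "M *v x + z - M *v y = M *v (x - y) + z" for x y
    by (simp_all add: matrix_vector_mult_diff_distrib matrix_vector_right_distrib)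
  show ?thesis
    by (simp add: X state_transition_def affine_state_def Let_def add n LM pos split: prod.split)
qed

lemma corner_data_affine:
  assumes LM: "\<And>x y. cross3 (L *v x) (L *v y) = M *v cross3 x y"
  shows "corner_data s (affine_state L M z X) p = map_prod ((*v) L) (\<lambda>x. M *v x + z) (corner_data s X p)"
proof -
  obtain a b c x where X: "X = (a, b, c, x)" using prod_cases4 by blast
  show ?thesis
    by (simp add: X corner_data_def affine_state_def LM matrix_vector_mult_diff_distrib
        matrix_vector_right_distrib)
qed

text \<open>Take the change of basis: the matrix with columns a', b', c' times the inverse of the
  one with columns a, b, c. Its determinant is a quotient of two equal numbers.\<close>

lemma ex_unimodular_matrix:
  fixes a b c a' b' c' :: "real^3"
  assumes "det3 a b c = det3 a' b' c'" "det3 a b c \<noteq> 0"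
  obtains L :: "real^3^3" where "det L = 1" "L *v a = a'" "L *v b = b'" "L *v c = c'"
proof -
  define P where "P x y z = transpose (vector [x, y, z] :: real^3^3)" for x y z :: "real^3"
  have P: "P x y z *v axis 1 1 = x" "P x y z *v axis 2 1 = y" "P x y z *v axis 3 1 = z"
    "det (P x y z) = det3 x y z" for x y z
    unfolding P_def det3_def det_transpose matrix_vector_mult_basis column_transpose
    by (simp_all add: row_def vec_eq_iff vector_3)
  have "invertible (P a b c)"
    using assms(2) by (simp add: invertible_det_nz P(4))
  then obtain Q where inv: "Q ** P a b c = mat 1"
    unfolding invertible_def by blast
  show ?thesis
  proof
    let ?L = "P a' b' c' ** Q"
    have "det Q * det (P a b c) = 1"
      using arg_cong[OF inv, of det] by (simp add: det_mul)
    then show "det ?L = 1"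
      using assms(1) by (simp add: det_mul P(4) mult.commute)
    have "?L *v (P a b c *v x) = P a' b' c' *v x" for x
      by (metis inv matrix_mul_assoc matrix_mul_rid matrix_vector_mul_assoc)
    then show "?L *v a = a'" "?L *v b = b'" "?L *v c = c'"
      by (metis P(1), metis P(2), metis P(3))
  qed
qed

text \<open>\<open>M\<close> is the inverse transpose of \<open>L\<close>, which is its cofactor
  matrix because the determinant is 1.\<close>

lemma cross3_unimodular:
  fixes L :: "real^3^3"
  assumes "det L = 1"
  obtains M where "invertible M" "\<And>x y. cross3 (L *v x) (L *v y) = M *v cross3 x y"
proof -
  have "invertible (transpose L)"
    using assms by (simp add: invertible_det_nz)
  then obtain M where M: "transpose L ** M = mat 1" "M ** transpose L = mat 1"
    unfolding invertible_def by blast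
  show ?thesis
  proof
    show "invertible M"
      using M unfolding invertible_def by blast
    fix x y
    have "transpose L *v cross3 (L *v x) (L *v y) = cross3 x y"
      using cross_matrix_mult[of L x y] assms by simp
    then show "cross3 (L *v x) (L *v y) = M *v cross3 x y"
      using M(2) by (metis matrix_vector_mul_assoc matrix_vector_mul_lid)
  qed
qed

lemma corner_data_surface_state:
  assumes cm: "conormal_map_of D q \<nu>" and s: "s \<in> squares D" "(u, v) \<in> corners s"
  shows "corner_data s (surface_state \<nu> q s) (u, v) = (\<nu> u v, q u v)"
proof -
  obtain m n where mn: "s = (m, n)" by fastforce
  have cm': "conormal_map D \<nu>" using cm by (simp add: conormal_map_of_def)
  note d = conormal_parallelogram[OF cm' s(1)[unfolded mn]]
  have q: "q (m + 1) k = q m k + cross3 (\<nu> m k) (\<nu> (m + 1) k)" if "k = n \<or> k = n + 1" for k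
    using conormal_map_of_diff1[OF cm] s(1) that unfolding mn square_vertices by blast
  have q': "q m (n + 1) = q m n - cross3 (\<nu> m n) (\<nu> m (n + 1))"
    using conormal_map_of_diff2[OF cm] s(1) unfolding mn square_vertices by blast
  have "x - cross3 a c + cross3 c (b + c - a) = x + cross3 c b" for x a b c
    by (simp add: vec_eq_iff forall_3 cross3_def vector_3 algebra_simps)
  then show ?thesis
    using s(2) by (auto simp: mn surface_state_def q q' d)
qed

text \<open>Equal metrics at \<open>s0\<close> provide \<open>L\<close> matching the co-normals
  there, \<open>M\<close> is induced by \<open>L\<close>, and \<open>z\<close> matches the
  positions. The relation then spreads along chains, since the transitions commute with it.\<close>

lemma affine_equivalent_of_transition:
  assumes D: "simply_connected_domain D" and pos: "\<And>u v. (u, v) \<in> squares D \<Longrightarrow> F u v > 0"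
    and cm: "conormal_map_of D q \<nu>" "conormal_map_of D q' \<nu>'"
    and F: "\<And>u v. (u, v) \<in> squares D \<Longrightarrow> conormal_metric \<nu> u v = F u v"
      "\<And>u v. (u, v) \<in> squares D \<Longrightarrow> conormal_metric \<nu>' u v = F u v"
    and tr: "\<And>s t. s \<in> squares D \<Longrightarrow> t \<in> squares D \<Longrightarrow> share_edge s t \<Longrightarrow>
        surface_state \<nu> q t = state_transition F A B s t (surface_state \<nu> q s)"
      "\<And>s t. s \<in> squares D \<Longrightarrow> t \<in> squares D \<Longrightarrow> share_edge s t \<Longrightarrow>
        surface_state \<nu>' q' t = state_transition F A B s t (surface_state \<nu>' q' s)"
    and s0: "s0 \<in> squares D"
  shows "affine_equivalent D q q'"
proof -
  obtain m n where mn: "s0 = (m, n)" by fastforce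
  have "det3 (\<nu> m n) (\<nu> m (n + 1)) (\<nu> (m + 1) n) = det3 (\<nu>' m n) (\<nu>' m (n + 1)) (\<nu>' (m + 1) n)"
    "det3 (\<nu> m n) (\<nu> m (n + 1)) (\<nu> (m + 1) n) \<noteq> 0"
    using F[of m n] pos[of m n] s0 by (simp_all add: mn conormal_metric_det3)
  then obtain L where L: "det L = 1" "L *v \<nu> m n = \<nu>' m n" "L *v \<nu> m (n + 1) = \<nu>' m (n + 1)"
    "L *v \<nu> (m + 1) n = \<nu>' (m + 1) n"
    by (rule ex_unimodular_matrix)
  obtain M where M: "invertible M" "\<And>x y. cross3 (L *v x) (L *v y) = M *v cross3 x y"
    using cross3_unimodular[OF L(1)] by blast
  define z where "z = q' m n - M *v q m n"
  have all: "surface_state \<nu>' q' s = affine_state L M z (surface_state \<nu> q s)" if "s \<in> squares D" for s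
    using D s0 _ _ that
  proof (rule squares_induct)
    show "surface_state \<nu>' q' s0 = affine_state L M z (surface_state \<nu> q s0)"
      by (simp add: mn surface_state_def affine_state_def L z_def)
  next
    fix s t
    assume "s \<in> squares D" "t \<in> squares D" "share_edge s t"
      "surface_state \<nu>' q' s = affine_state L M z (surface_state \<nu> q s)"
    then show "surface_state \<nu>' q' t = affine_state L M z (surface_state \<nu> q t)"
      using state_transition_affine[where L = L and M = M, OF M(2)] tr by simp
  qed
  have "q' u v = M *v q u v + z" if uv: "(u, v) \<in> D" for u v
  proof -
    obtain s where s: "s \<in> squares D" "(u, v) \<in> corners s"
      using D uv unfolding simply_connected_domain_def by blast
    have "(\<nu>' u v, q' u v) = map_prod ((*v) L) (\<lambda>x. M *v x + z) (\<nu> u v, q u v)"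
      unfolding corner_data_surface_state[OF cm(1) s, symmetric]
        corner_data_surface_state[OF cm(2) s, symmetric] all[OF s(1)]
      by (rule corner_data_affine[OF M(2)])
    then show ?thesis by simp
  qed
  with M(1) show ?thesis
    unfolding affine_equivalent_def by blast
qed

theorem theorem10:
  fixes D :: "(int \<times> int) set" and F A B :: "int \<Rightarrow> int \<Rightarrow> real"
  assumes "simply_connected_domain D"
    and "\<And>u v. (u, v) \<in> squares D \<Longrightarrow> F u v > 0"
    and "\<And>u v. interior_vertex D u v \<Longrightarrow>
      F (u - 1) v * F u (v - 1) - F u v * F (u - 1) (v - 1) = A u v * B u v"
    and "\<And>u v. interior_vertex D u v \<Longrightarrow>
      F (u - 1) (v - 1) * diff1 B u v - F u (v - 1) * diff1 B (u - 1) v = B u v * diff2 A u (v - 1)"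
    and "\<And>u v. interior_vertex D u v \<Longrightarrow>
      F (u - 1) (v - 1) * diff2 A u v - F (u - 1) v * diff2 A u (v - 1) = A u v * diff1 B (u - 1) v"
  shows "(\<exists>q. affine_minimal_surface D q \<and> has_quadratic_form D q F \<and> has_cubic_form D q F A B) \<and>
    (\<forall>q q'. affine_minimal_surface D q \<and> has_quadratic_form D q F \<and> has_cubic_form D q F A B \<and>
      affine_minimal_surface D q' \<and> has_quadratic_form D q' F \<and> has_cubic_form D q' F A B \<longrightarrow>
      affine_equivalent D q q')"
proof (cases "squares D = {}")
  \<comment> \<open>A domain without squares is empty, so every condition is vacuous and the
    identity serves as affine map.\<close>
  case True
  then have "D = {}"
    using assms(1) unfolding simply_connected_domain_def by blast
  moreover have "invertible (mat 1 :: real^3^3)"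
    unfolding invertible_def by (intro exI[of _ "mat 1"]) simp
  ultimately have "conormal_map_of D q \<nu>" "has_cubic_form D q F A B" "affine_equivalent D q q'" for q q' \<nu>
    using True
    by (auto simp: conormal_map_of_def conormal_map_def has_cubic_form_def affine_equivalent_def)
  then show ?thesis
    using True unfolding affine_minimal_surface_def has_quadratic_form_def by blast
next
  case False
  then obtain s0 where s0: "s0 \<in> squares D" by blast
  have nz: "F u v \<noteq> 0" if "(u, v) \<in> squares D" for u v
    using assms(2)[OF that] by simp
  interpret square_transport D "state_transition F A B"
  proof
    show "simply_connected_domain D" by (rule assms(1))
    show "state_transition F A B t s (state_transition F A B s t X) = X"
      if "s \<in> squares D" "t \<in> squares D" "share_edge s t" for s t X
      by (rule state_transition_inverse) (use that nz in simp_all)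
    show "state_transition F A B (u + 1, v) (u + 1, v + 1) (state_transition F A B (u, v) (u + 1, v) X) =
        state_transition F A B (u, v + 1) (u + 1, v + 1) (state_transition F A B (u, v) (u, v + 1) X)"
      if h: "{u, u + 1} \<times> {v, v + 1} \<subseteq> squares D" for u v X
    proof -
      \<comment> \<open>This is the vertex common to the four squares.\<close>
      have "interior_vertex D (u + 1) (v + 1)"
        using h by (simp add: interior_vertex_def)
      from assms(3-5)[OF this] show ?thesis
        using h by (intro state_transition_commute) (auto simp: nz diff1_def diff2_def add.assoc)
    qed
  qed
  \<comment> \<open>Multiples of the unit vectors, ordered so that \<open>det3 a c b\<close> is the
    prescribed metric at \<open>s0\<close>; the position is put at the origin.\<close>
  define x0 :: state where
    "x0 = (vector [F (fst s0) (snd s0), 0, 0], vector [0, 0, 1], vector [0, 1, 0], 0)"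
  obtain \<Phi> where \<Phi>: "\<Phi> s0 = x0" "\<And>s t. s \<in> squares D \<Longrightarrow> t \<in> squares D \<Longrightarrow> share_edge s t \<Longrightarrow>
      \<Phi> t = state_transition F A B s t (\<Phi> s)"
    using ex_section[OF s0, of x0] by metis
  have metric: "state_metric (\<Phi> s) = F (fst s) (snd s)" if "s \<in> squares D" for s
    using assms(1) s0 _ _ that
  proof (rule squares_induct)
    show "state_metric (\<Phi> s0) = F (fst s0) (snd s0)"
      by (simp add: \<Phi>(1) x0_def state_metric_def det3_def det_3 vector_3)
  next
    fix s t
    assume "s \<in> squares D" "t \<in> squares D" "share_edge s t" "state_metric (\<Phi> s) = F (fst s) (snd s)"
    then show "state_metric (\<Phi> t) = F (fst t) (snd t)"
      using state_metric_transition[of F s t "\<Phi> s" A B] \<Phi>(2) nz by simp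
  qed
  obtain q \<nu> where \<nu>: "conormal_map_of D q \<nu>"
    "\<And>u v. (u, v) \<in> squares D \<Longrightarrow> conormal_metric \<nu> u v = F u v"
    "\<And>s. s \<in> squares D \<Longrightarrow> surface_state \<nu> q s = \<Phi> s"
    using ex_surface_of_states[where F = F and A = A and B = B and \<Phi> = \<Phi>,
        OF assms(1,2) \<Phi>(2) metric] by blast
  have "has_cubic_form D q F A B"
  proof (rule has_cubic_form_of_transition[OF assms(1) \<nu>(1)])
    show "surface_state \<nu> q t = state_transition F A B s t (surface_state \<nu> q s)"
      if "s \<in> squares D" "t \<in> squares D" "share_edge s t" for s t
      using \<Phi>(2)[OF that] that by (simp only: \<nu>(3))
  qed (rule \<nu>(2))
  moreover have "affine_minimal_surface D q" "has_quadratic_form D q F"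
    using \<nu>(1,2) unfolding affine_minimal_surface_def has_quadratic_form_def by blast+
  moreover have "affine_equivalent D q q'"
    if q: "has_quadratic_form D q F" "has_cubic_form D q F A B"
      and q': "has_quadratic_form D q' F" "has_cubic_form D q' F A B" for q q'
  proof -
    obtain \<nu> where \<nu>: "conormal_map_of D q \<nu>" "\<And>u v. (u, v) \<in> squares D \<Longrightarrow> conormal_metric \<nu> u v = F u v"
      using q(1) unfolding has_quadratic_form_def by blast
    obtain \<nu>' where \<nu>': "conormal_map_of D q' \<nu>'" "\<And>u v. (u, v) \<in> squares D \<Longrightarrow> conormal_metric \<nu>' u v = F u v"
      using q'(1) unfolding has_quadratic_form_def by blast
    have tr: "surface_state \<nu> q t = state_transition F A B s t (surface_state \<nu> q s)"
      "surface_state \<nu>' q' t = state_transition F A B s t (surface_state \<nu>' q' s)"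
      if "s \<in> squares D" "t \<in> squares D" "share_edge s t" for s t
      using surface_state_transition[where F = F, OF \<nu> q(2) that]
        surface_state_transition[where F = F, OF \<nu>' q'(2) that] by simp_all
    show ?thesis
      by (rule affine_equivalent_of_transition[where F = F and A = A and B = B,
            OF assms(1,2) \<nu>(1) \<nu>'(1) \<nu>(2) \<nu>'(2) tr s0])
  qed
  ultimately show ?thesis by blast
qed

end
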